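(* Let $n\ge3$ and let $\mathcal{Z}^n(B)$ denote the space of origin-symmetric zonoids contained in the unit ball $B$ in $\mathbb{R}^n$, endowed with the Hausdorff metric. Then for all $0<t<1/2$ and any $\eta>0$, $$H(t,\mathcal{Z}^n(B))=O\left(t^{-2(n-1)/(n+2)-\eta}\right),$$ that is, for every $\eta>0$ there is a constant $c=c(n,\eta)$ such that $H(t,\mathcal{Z}^n(B))\le c\,t^{-2(n-1)/(n+2)-\eta}$ for all $0<t<1/2$.
   Context: A zonotope is a vector (Minkowski) sum of finitely many line segments; a zonoid is a limit of zonotopes in the Hausdorff metric. With $h_L(x)=\max\{x\cdot y:y\in L\}$, the Hausdorff metric is $\delta(K,L)=\sup_{u\in S^{n-1}}|h_K(u)-h_L(u)|$. For a set $S$ with a pseudometric $d$ and $t>0$, a $t$-net is a subset $U\subset S$ such that each point of $S$ is within $d$-distance at most $t$ of some point of $U$. The $t$-covering number $N(t,S)$ is the least cardinality of all $t$-nets, and $H(t,S)=\log N(t,S)$ is the $t$-entropy of $S$. *)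

theory Defs
  imports "HOL-Analysis.Analysis" "HOL-Library.Set_Algebras" "HOL-Library.Extended_Real"
begin

definition support_fn :: "'a::real_inner set \<Rightarrow> 'a \<Rightarrow> real" where
  "support_fn L x = (SUP y\<in>L. x \<bullet> y)"

lemma support_fn_attained:
  assumes "compact L" "L \<noteq> {}"
  obtains y where "y \<in> L" "support_fn L x = x \<bullet> y" "\<And>z. z \<in> L \<Longrightarrow> x \<bullet> z \<le> x \<bullet> y"
proof -
  have "continuous_on L (\<lambda>y. x \<bullet> y)"
    by (intro continuous_intros)
  then obtain y where y: "y \<in> L" "\<And>z. z \<in> L \<Longrightarrow> x \<bullet> z \<le> x \<bullet> y"
    using continuous_attains_sup[OF assms] by blast
  have "support_fn L x = x \<bullet> y"
    unfolding support_fn_def using y by (intro cSup_eq_maximum) auto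
  with y that show thesis by blast
qed

text \<open>A metric only on nonempty compact convex sets; elsewhere the real-valued suprema carry no
  meaning.\<close>
definition hausdorff_metric :: "'a::real_inner set \<Rightarrow> 'a set \<Rightarrow> real" where
  "hausdorff_metric K L = (SUP u\<in>sphere 0 1. \<bar>support_fn K u - support_fn L u\<bar>)"

text \<open>The sum of sets is the Minkowski sum; segments may be degenerate, and the empty sum
  is the set containing only the origin.\<close>
definition zonotope :: "'a::real_vector set \<Rightarrow> bool" where
  "zonotope Z \<longleftrightarrow> (\<exists>(m::nat) a b. Z = (\<Sum>i<m. closed_segment (a i) (b i)))"

text \<open>The limit is taken in the space of nonempty compact convex sets, on which
  \<^const>\<open>hausdorff_metric\<close> is a metric. No interior points are required.\<close>
definition zonoid :: "'a::euclidean_space set \<Rightarrow> bool" where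
  "zonoid K \<longleftrightarrow> compact K \<and> convex K \<and> K \<noteq> {} \<and>
     (\<exists>Z :: nat \<Rightarrow> 'a set. (\<forall>i. zonotope (Z i)) \<and>
        (\<lambda>i. hausdorff_metric (Z i) K) \<longlonglongrightarrow> 0)"

definition symmetric_zonoids_in_ball :: "'a::euclidean_space set set" where
  "symmetric_zonoids_in_ball = {K. zonoid K \<and> uminus ` K = K \<and> K \<subseteq> cball 0 1}"

definition is_net :: "('s \<Rightarrow> 's \<Rightarrow> real) \<Rightarrow> real \<Rightarrow> 's set \<Rightarrow> 's set \<Rightarrow> bool" where
  "is_net d t S U \<longleftrightarrow> U \<subseteq> S \<and> (\<forall>x\<in>S. \<exists>y\<in>U. d x y \<le> t)"

text \<open>The cardinality of an infinite net counts as \<open>\<infinity>\<close> (and not as \<open>0\<close>, as \<^const>\<open>card\<close> would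
  have it), so the covering number is finite exactly when a finite net exists.\<close>
definition covering_number :: "('s \<Rightarrow> 's \<Rightarrow> real) \<Rightarrow> real \<Rightarrow> 's set \<Rightarrow> enat" where
  "covering_number d t S = (INF U\<in>{U. is_net d t S U}. if finite U then enat (card U) else \<infinity>)"

definition net_entropy :: "('s \<Rightarrow> 's \<Rightarrow> real) \<Rightarrow> real \<Rightarrow> 's set \<Rightarrow> ereal" where
  "net_entropy d t S =
     (case covering_number d t S of enat N \<Rightarrow> ereal (ln (real N)) | \<infinity> \<Rightarrow> \<infinity>)"

end

theory Submission
  imports Defs "HOL-Real_Asymp.Real_Asymp"
begin

text \<open>
  A symmetric zonoid in the unit ball is a limit of zonotopes with support functions
  \<open>\<lambda>u. \<Sum>x\<leftarrow>xs. \<bar>u \<bullet> x\<bar>\<close>, where the vectors in \<open>xs\<close> have bounded total size but may be arbitrarily many. The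
  idea is to approximate such a function within \<open>t\<close> by one with only
  \<open>N\<close> vectors, where \<open>N\<close> is about \<open>t powr (- 2 * (n - 1) / (n + 2))\<close>, and to round the coordinates of these
  vectors to a lattice whose mesh is a power of \<open>t\<close>. The number of lattice codes is exponential in \<open>N\<close> up to a
  logarithmic factor in the exponent, and its logarithm bounds the entropy. The surplus \<open>\<eta>\<close> in the exponent pays for
  all logarithms.

  The number of vectors is reduced from \<open>M\<close> to \<open>q * M\<close> with a fixed \<open>q < 1\<close> again and again. In one round,
  groups of \<open>n + 1\<close> vectors are formed. In each group a linear relation \<open>\<Sum>i. C i *\<^sub>R a i = 0\<close> allows the lengths to be
  changed by the factors \<open>1 + C i\<close> or \<open>1 - C i\<close>, and one of the two choices deletes a vector. The change of
  \<open>\<Sum>i. \<bar>u \<bullet> a i\<bar>\<close> is zero unless the hyperplane orthogonal to \<open>u\<close> separates the group, because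
  \<open>\<bar>u \<bullet> a i\<bar>\<close> is linear in \<open>a i\<close> otherwise. With random signs the changes of the separated groups add up
  like the square root of their number.

  The groups have to be narrow, of angular width about \<open>1 / r\<close>, and every \<open>u\<close> may separate only a
  fraction \<open>1 / r\<close> of them, where \<open>r\<close> is about \<open>M powr (1 / (n - 1))\<close>. Both properties come from
  one arrangement of about \<open>r\<close> hyperplanes through the origin (\<open>ex_narrow_group\<close>): its cells number at most about
  \<open>r ^ (n - 1)\<close> by the Sauer--Shelah lemma (\<open>card_sign_patterns_le\<close>), so that some cell contains many
  vectors. Reweighting the directions \<open>u\<close> after each group makes the second property hold for every \<open>u\<close>
  (\<open>ex_many_narrow_groups\<close>). Vectors of size \<open>1 / M\<close>, width \<open>1 / r\<close> and \<open>M / r\<close> separated groups give the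
  error \<open>1 / M * 1 / r * sqrt (M / r)\<close>, which is \<open>M powr (- (n + 2) / (2 * (n - 1)))\<close>. The errors of all rounds form
  a geometric series (\<open>ex_few_segments\<close>), and solving for \<open>M\<close> gives the exponent of the theorem.

  All direction-dependent choices are made on a finite net of directions whose size is polynomial in \<open>1 / t\<close>;
  Lipschitz continuity extends the estimates to the sphere.
\<close>

section \<open>Counting sign patterns\<close>

definition shatters :: "'a set set \<Rightarrow> 'a set \<Rightarrow> bool" where
  "shatters \<F> S \<longleftrightarrow> (\<forall>T\<subseteq>S. \<exists>A\<in>\<F>. A \<inter> S = T)"

lemma shatters_mono: "shatters \<F> S \<Longrightarrow> \<F> \<subseteq> \<G> \<Longrightarrow> shatters \<G> S"
  unfolding shatters_def by (meson subsetD)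

text \<open>Pajor's form of the Sauer--Shelah lemma. Induction on the ground set: the members of the family
  without \<open>x\<close>, and the members with \<open>x\<close> after \<open>x\<close> has been deleted from them, are families on the
  smaller ground set. A set shattered by both parts counts twice on the right because it stays
  shattered when \<open>x\<close> is added.\<close>

lemma card_le_card_shattered:
  assumes "finite X" "\<F> \<subseteq> Pow X"
  shows "card \<F> \<le> card {S. S \<subseteq> X \<and> shatters \<F> S}"
  using assms
proof (induction X arbitrary: \<F> rule: finite_induct)
  case empty
  show ?case
  proof (cases "\<F> = {}")
    case False
    with empty have "\<F> = {{}}" by auto
    then have "{S. S \<subseteq> {} \<and> shatters \<F> S} = {{}}" by (auto simp: shatters_def)
    with \<open>\<F> = {{}}\<close> show ?thesis by simp
  qed simp
next
  case (insert x X)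
  define F0 where "F0 = {A\<in>\<F>. x \<notin> A}"
  define F1 where "F1 = (\<lambda>A. A - {x}) ` {A\<in>\<F>. x \<in> A}"
  define S0 where "S0 = {S. S \<subseteq> X \<and> shatters F0 S}"
  define S1 where "S1 = {S. S \<subseteq> X \<and> shatters F1 S}"
  have fin: "finite \<F>" using insert.prems insert.hyps by (meson finite_Pow_iff finite_insert finite_subset)
  have finS: "finite S0" "finite S1" using insert.hyps by (auto simp: S0_def S1_def)
  have F0: "F0 \<subseteq> Pow X" using insert.prems by (auto simp: F0_def)
  have F1: "F1 \<subseteq> Pow X" using insert.prems by (auto simp: F1_def)
  have inj: "inj_on (\<lambda>A. A - {x}) {A\<in>\<F>. x \<in> A}" by (auto simp: inj_on_def)
  have "card \<F> = card F0 + card {A\<in>\<F>. x \<in> A}"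
    unfolding F0_def using fin by (subst card_Un_disjoint[symmetric]) (auto intro!: arg_cong[where f=card])
  also have "card {A\<in>\<F>. x \<in> A} = card F1" unfolding F1_def using inj by (simp add: card_image)
  finally have "card \<F> \<le> card S0 + card S1"
    using insert.IH[OF F0] insert.IH[OF F1] unfolding S0_def S1_def by linarith
  also have "\<dots> = card (S0 \<union> S1) + card (insert x ` (S0 \<inter> S1))"
  proof -
    have "inj_on (insert x) (S0 \<inter> S1)"
      using insert.hyps by (auto simp: inj_on_def S0_def S1_def)
    then show ?thesis by (simp add: card_image card_Un_Int[OF finS])
  qed
  also have "\<dots> = card ((S0 \<union> S1) \<union> insert x ` (S0 \<inter> S1))"
    using finS insert.hyps by (intro card_Un_disjoint[symmetric]) (auto simp: S0_def S1_def)
  also have "\<dots> \<le> card {S. S \<subseteq> insert x X \<and> shatters \<F> S}"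
  proof (rule card_mono)
    show "finite {S. S \<subseteq> insert x X \<and> shatters \<F> S}" using insert.hyps by simp
    have a: "shatters \<F> S" if "S \<in> S0" for S
      using that shatters_mono[of F0 S \<F>] by (auto simp: S0_def F0_def)
    have b: "shatters \<F> S" if "S \<in> S1" for S
      unfolding shatters_def
    proof (intro allI impI)
      fix T assume "T \<subseteq> S"
      then have "\<exists>B\<in>F1. B \<inter> S = T" using that by (simp add: S1_def shatters_def)
      then obtain B where B: "B \<in> F1" "B \<inter> S = T" by blast
      then obtain A where A: "A \<in> \<F>" "(A - {x}) \<inter> S = T" unfolding F1_def by blast
      moreover have "x \<notin> S" using that insert.hyps by (auto simp: S1_def)
      ultimately have "A \<inter> S = T" by blast
      then show "\<exists>A\<in>\<F>. A \<inter> S = T" using A by blast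
    qed
    have c: "shatters \<F> (insert x S)" if "S \<in> S0" "S \<in> S1" for S
      unfolding shatters_def
    proof (intro allI impI)
      fix T assume T: "T \<subseteq> insert x S"
      have x: "x \<notin> S" using that insert.hyps by (auto simp: S1_def)
      show "\<exists>A\<in>\<F>. A \<inter> insert x S = T"
      proof (cases "x \<in> T")
        case True
        have "T - {x} \<subseteq> S" using T by blast
        then have "\<exists>B\<in>F1. B \<inter> S = T - {x}" using that(2) by (simp add: S1_def shatters_def)
        then obtain B where B: "B \<in> F1" "B \<inter> S = T - {x}" by blast
        then obtain A where A: "A \<in> \<F>" "x \<in> A" "(A - {x}) \<inter> S = T - {x}"
          unfolding F1_def by blast
        then have "A \<inter> insert x S = T" using True x by blast
        then show ?thesis using A by blast
      next
        case False
        then have "T \<subseteq> S" using T by blast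
        then have "\<exists>A\<in>F0. A \<inter> S = T" using that(1) by (simp add: S0_def shatters_def)
        then obtain A where A: "A \<in> F0" "A \<inter> S = T" by blast
        then have A': "A \<in> \<F>" "x \<notin> A" by (auto simp: F0_def)
        with A have "A \<inter> insert x S = T" by blast
        then show ?thesis using A' by blast
      qed
    qed
    show "S0 \<union> S1 \<union> insert x ` (S0 \<inter> S1) \<subseteq> {S. S \<subseteq> insert x X \<and> shatters \<F> S}"
      using a b c by (auto simp: S0_def S1_def)
  qed
  finally show ?case .
qed

lemma card_subsets_le_power:
  assumes "finite X"
  shows "card {S. S \<subseteq> X \<and> card S \<le> d} \<le> (card X + 1) ^ d"
  using assms
proof (induction X arbitrary: d rule: finite_induct)
  case empty
  have "{S. S \<subseteq> {} \<and> card S \<le> d} = {{}}" by auto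
  then have "card {S. S \<subseteq> {} \<and> card S \<le> d} = 1" by (metis is_singletonI is_singleton_altdef)
  then show ?case by (metis le_refl one_le_power le_add2)
next
  case (insert x X)
  show ?case
  proof (cases d)
    case 0
    have "{S. S \<subseteq> insert x X \<and> card S \<le> d} = {{}}" using 0 insert.hyps
      by (auto simp: card_eq_0_iff dest: finite_subset)
    then show ?thesis using 0 by simp
  next
    case (Suc e)
    have "{S. S \<subseteq> insert x X \<and> card S \<le> d} \<subseteq>
       {S. S \<subseteq> X \<and> card S \<le> d} \<union> insert x ` {S. S \<subseteq> X \<and> card S \<le> e}" (is "?A \<subseteq> ?B \<union> ?C")
    proof
      fix S assume S: "S \<in> ?A"
      show "S \<in> ?B \<union> ?C"
      proof (cases "x \<in> S")
        case True
        have fS: "finite S" using S insert.hyps by (auto dest: finite_subset)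
        have "S - {x} \<subseteq> X" "card (S - {x}) \<le> e" "S = insert x (S - {x})"
          using S True Suc fS by auto
        then show ?thesis by blast
      qed (use S in auto)
    qed
    then have "card ?A \<le> card ?B + card ?C"
      using insert.hyps(1)
      by (intro order.trans[OF card_mono card_Un_le]) (auto intro!: finite_imageI)
    also have "\<dots> \<le> (card X + 1) ^ d + (card X + 1) ^ e"
      using insert.IH[of d] insert.IH[of e] card_image_le[of "{S. S \<subseteq> X \<and> card S \<le> e}" "insert x"] insert.hyps
      by fastforce
    also have "\<dots> = (card X + 1) ^ e * (card X + 2)" using Suc by simp
    also have "\<dots> \<le> (card X + 2) ^ e * (card X + 2)" by (intro mult_right_mono power_mono) auto
    finally show ?thesis using Suc insert.hyps by (simp add: mult.commute)
  qed
qed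

text \<open>A linear relation between \<open>e\<close> and the functionals in \<open>S\<close> would be contradicted by a vector that is
  positive exactly on those functionals whose coefficient is positive: all terms of the relation
  would be nonnegative and one of them positive. Restricting to the open half space of \<open>e\<close> is what
  saves one dimension.\<close>

lemma independent_if_shattered:
  fixes e :: "'a::euclidean_space"
  assumes e: "\<And>v. v \<in> V \<Longrightarrow> 0 < e \<bullet> v" and S: "finite S" "S \<subseteq> F"
    and sh: "shatters ((\<lambda>v. {f\<in>F. 0 < f \<bullet> v}) ` V) S"
  shows "e \<notin> S \<and> independent (insert e S)"
proof -
  have pat: "\<exists>v\<in>V. \<forall>f\<in>S. 0 < f \<bullet> v \<longleftrightarrow> f \<in> T" if T: "T \<subseteq> S" for T
  proof -
    obtain v where "v \<in> V" "{f\<in>F. 0 < f \<bullet> v} \<inter> S = T"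
      using sh T unfolding shatters_def by blast
    then show ?thesis using S(2) by (intro bexI[of _ v]) auto
  qed
  have eS: "e \<notin> S" using pat[of "{}"] e by force
  have key: False if c: "(\<Sum>f\<in>S. c f *\<^sub>R f) + c0 *\<^sub>R e = 0" and nz: "c0 > 0 \<or> (c0 = 0 \<and> (\<exists>f\<in>S. c f > 0))"
    for c c0
  proof -
    obtain v where v: "v \<in> V" "\<forall>f\<in>S. 0 < f \<bullet> v \<longleftrightarrow> f \<in> {f\<in>S. c f > 0}"
      using pat[of "{f\<in>S. c f > 0}"] by auto
    have nn: "c f * (f \<bullet> v) \<ge> 0" if "f \<in> S" for f
    proof (cases "c f > 0")
      case True then show ?thesis using v(2) that by (intro mult_nonneg_nonneg) auto
    next
      case False then show ?thesis using v(2) that by (intro mult_nonpos_nonpos) (auto simp: not_less)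
    qed
    have "0 = ((\<Sum>f\<in>S. c f *\<^sub>R f) + c0 *\<^sub>R e) \<bullet> v" using c by simp
    also have "\<dots> = (\<Sum>f\<in>S. c f * (f \<bullet> v)) + c0 * (e \<bullet> v)"
      by (simp add: inner_add_left inner_sum_left)
    finally have eq: "(\<Sum>f\<in>S. c f * (f \<bullet> v)) + c0 * (e \<bullet> v) = 0" by simp
    have s0: "(\<Sum>f\<in>S. c f * (f \<bullet> v)) \<ge> 0" using nn by (rule sum_nonneg)
    from nz show False
    proof
      assume "c0 > 0"
      then have "c0 * (e \<bullet> v) > 0" using e[OF v(1)] by simp
      with s0 eq show False by linarith
    next
      assume h: "c0 = 0 \<and> (\<exists>f\<in>S. c f > 0)"
      then obtain f where f: "f \<in> S" "c f > 0" by blast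
      then have "0 < c f * (f \<bullet> v)" using v(2) by auto
      then have "(\<Sum>f\<in>S. c f * (f \<bullet> v)) > 0" using nn f(1) S(1) by (meson sum_pos2)
      then show False using eq h by simp
    qed
  qed
  have "independent (insert e S)"
  proof
    assume "dependent (insert e S)"
    then obtain c where c: "(\<Sum>v\<in>insert e S. c v *\<^sub>R v) = 0" "\<exists>v\<in>insert e S. c v \<noteq> 0"
      using S(1) by (subst (asm) dependent_finite) auto
    have c1: "(\<Sum>f\<in>S. c f *\<^sub>R f) + c e *\<^sub>R e = 0" using c(1) S(1) eS by (simp add: add.commute)
    then have c2: "(\<Sum>f\<in>S. (- c f) *\<^sub>R f) + (- c e) *\<^sub>R e = 0"
      by (simp add: sum_negf) (metis add.inverse_inverse eq_neg_iff_add_eq_0 neg_equal_iff_equal)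
    consider "c e > 0" | "c e < 0" | "c e = 0" "\<exists>f\<in>S. c f > 0" | "c e = 0" "\<exists>f\<in>S. c f < 0"
      using c(2) by (metis insertE linorder_neqE_linordered_idom)
    then show False
      using key[OF c1] key[OF c2] by cases auto
  qed
  with eS show ?thesis by blast
qed

text \<open>This bound counts the cells of an arrangement of hyperplanes through the origin inside a half
  space. The exponent is \<open>DIM('a) - 1\<close>, not \<open>DIM('a)\<close>, and this is what the exponent of the theorem
  rests on.\<close>

lemma card_sign_patterns_le:
  fixes e :: "'a::euclidean_space"
  assumes e: "\<And>v. v \<in> V \<Longrightarrow> 0 < e \<bullet> v" and F: "finite F"
  shows "card ((\<lambda>v. {f\<in>F. 0 < f \<bullet> v}) ` V) \<le> (card F + 1) ^ (DIM('a) - 1)"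
proof -
  let ?P = "(\<lambda>v. {f\<in>F. 0 < f \<bullet> v}) ` V"
  have "card ?P \<le> card {S. S \<subseteq> F \<and> shatters ?P S}"
    using F by (intro card_le_card_shattered) auto
  also have "\<dots> \<le> card {S. S \<subseteq> F \<and> card S \<le> DIM('a) - 1}"
  proof (rule card_mono)
    show "finite {S. S \<subseteq> F \<and> card S \<le> DIM('a) - 1}" using F by simp
    show "{S. S \<subseteq> F \<and> shatters ?P S} \<subseteq> {S. S \<subseteq> F \<and> card S \<le> DIM('a) - 1}"
    proof safe
      fix S assume S: "S \<subseteq> F" "shatters ?P S"
      have fS: "finite S" using S F finite_subset by blast
      have "e \<notin> S" "independent (insert e S)"
        using independent_if_shattered[OF e fS S] by auto
      then have "Suc (card S) \<le> DIM('a)"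
        using independent_bound[of "insert e S"] fS by auto
      then show "card S \<le> DIM('a) - 1" by simp
    qed
  qed
  also have "\<dots> \<le> (card F + 1) ^ (DIM('a) - 1)" by (rule card_subsets_le_power[OF F])
  finally show ?thesis .
qed

section \<open>Narrow groups of vectors\<close>

text \<open>Averaging over \<open>w\<close> gives one \<open>u\<close> that hits at least a fraction \<open>\<rho>\<close> of the items that are still
  unhit; repeating this is a derandomised sampling of \<open>m\<close> elements from \<open>w\<close>.\<close>

lemma greedy_hitting_set:
  fixes w :: "'u \<Rightarrow> real"
  assumes P: "finite P" and U: "finite U" and w: "\<And>u. u \<in> U \<Longrightarrow> 0 < w u" 
    and U0: "U \<noteq> {}"
    and heavy: "\<And>p. p \<in> P \<Longrightarrow> \<rho> * sum w U \<le> (\<Sum>u\<in>{u\<in>U. hit u p}. w u)" and \<rho>: "\<rho> \<le> 1"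
  shows "\<exists>F\<subseteq>U. card F \<le> m \<and> real (card {p\<in>P. \<forall>u\<in>F. \<not> hit u p}) \<le> (1 - \<rho>) ^ m * real (card P)"
proof (induction m)
  case 0
  show ?case by (intro exI[of _ "{}"]) simp
next
  case (Suc m)
  then obtain F where F: "F \<subseteq> U" "card F \<le> m"
    "real (card {p\<in>P. \<forall>u\<in>F. \<not> hit u p}) \<le> (1 - \<rho>) ^ m * real (card P)" by blast
  define R where "R = {p\<in>P. \<forall>u\<in>F. \<not> hit u p}"
  have finR: "finite R" using P by (simp add: R_def)
  have W: "sum w U > 0" using U U0 w by (simp add: sum_pos)
  have "\<exists>u\<in>U. \<rho> * card R \<le> card {p\<in>R. hit u p}"
  proof (rule ccontr)
    assume "\<not> ?thesis"
    then have less: "\<And>u. u \<in> U \<Longrightarrow> real (card {p\<in>R. hit u p}) < \<rho> * card R" by force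
    have "\<rho> * card R * sum w U = (\<Sum>p\<in>R. \<rho> * sum w U)" by simp
    also have "\<dots> \<le> (\<Sum>p\<in>R. \<Sum>u\<in>{u\<in>U. hit u p}. w u)"
      by (intro sum_mono heavy) (auto simp: R_def)
    also have "\<dots> = (\<Sum>u\<in>U. \<Sum>p\<in>{p\<in>R. hit u p}. w u)"
      using finR U by (rule sum.swap_restrict)
    also have "\<dots> = (\<Sum>u\<in>U. w u * card {p\<in>R. hit u p})" by (simp add: mult.commute)
    also have "\<dots> < (\<Sum>u\<in>U. w u * (\<rho> * card R))"
      using U U0 w less by (intro sum_strict_mono mult_strict_left_mono) auto
    also have "\<dots> = \<rho> * card R * sum w U" by (subst sum_distrib_right[symmetric]) (rule mult.commute)
    finally show False by simp
  qed
  then obtain u where u: "u \<in> U" "\<rho> * card R \<le> card {p\<in>R. hit u p}" by blast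
  have "{p\<in>P. \<forall>u\<in>insert u F. \<not> hit u p} = R - {p\<in>R. hit u p}" by (auto simp: R_def)
  then have "real (card {p\<in>P. \<forall>u\<in>insert u F. \<not> hit u p}) = real (card R) - card {p\<in>R. hit u p}"
    using finR by (simp add: card_Diff_subset card_mono of_nat_diff)
  also have "\<dots> \<le> (1 - \<rho>) * card R" using u(2) by (simp add: algebra_simps)
  also have "\<dots> \<le> (1 - \<rho>) * ((1 - \<rho>) ^ m * real (card P))"
    using F(3) \<rho> unfolding R_def by (intro mult_left_mono) auto
  finally have "real (card {p\<in>P. \<forall>u\<in>insert u F. \<not> hit u p}) \<le> (1 - \<rho>) ^ Suc m * real (card P)"
    by simp
  moreover have "card (insert u F) \<le> Suc m" using F(2) 
    using card_insert_le_m1[of "Suc m" F u] by simp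
  ultimately show ?case using F u by (intro exI[of _ "insert u F"]) auto
qed

lemma pigeonhole_fibre:
  assumes "finite I" "card I > k * p" "card (f ` I) \<le> p"
  shows "\<exists>y. k < card {i\<in>I. f i = y}"
proof (rule ccontr)
  assume "\<not> ?thesis"
  then have le: "card {i\<in>I. f i = y} \<le> k" for y by (simp add: not_less)
  have "card I = (\<Sum>y\<in>f ` I. card {i\<in>I. f i = y})"
    using sum.image_gen[OF assms(1), of "\<lambda>_. 1::nat" f] by simp
  also have "\<dots> \<le> (\<Sum>y\<in>f ` I. k)" by (intro sum_mono le)
  also have "\<dots> \<le> p * k" using assms(3) by simp
  finally show False using assms(2) by (simp add: mult.commute)
qed

text \<open>Strict positivity on one side and its negation on the other, so that the vectors of a group that
  \<open>u\<close> does not cross all belong to one class of the sign patterns counted above.\<close>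

definition crosses :: "'a::real_inner \<Rightarrow> ('i \<Rightarrow> 'a) \<Rightarrow> 'i set \<Rightarrow> bool" where
  "crosses u a G \<longleftrightarrow> (\<exists>i\<in>G. \<exists>l\<in>G. 0 < u \<bullet> a i \<and> u \<bullet> a l \<le> 0)"

text \<open>The vectors lie in one chart: \<open>b\<close> is their coordinate of largest modulus, and dividing by it
  gives points of a cube in an affine hyperplane. Consider the arrangement that consists of a
  sample of \<open>m\<close> directions from \<open>U\<close>, hitting every pair that is separated by a weight fraction
  of at least \<open>1 / r\<close>, together with \<open>DIM('a) * (2 * r + 1)\<close> grid hyperplanes of the chart. Vectors in one
  cell of the arrangement agree up to \<open>1 / r\<close> in the chart and no two of them form a heavy pair. By the bound on sign
  patterns there are fewer cells than vectors, so the pigeonhole principle yields the group.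
  Using both families of hyperplanes in one arrangement is essential: refining a grid cell
  by a second arrangement would multiply the two numbers of cells.\<close>

lemma ex_narrow_group:
  fixes a :: "'i \<Rightarrow> 'a::euclidean_space" and w :: "'a \<Rightarrow> real"
  assumes I: "finite I" and b: "b \<in> Basis"
    and pos: "\<And>i. i \<in> I \<Longrightarrow> 0 < a i \<bullet> b"
    and big: "\<And>i c. i \<in> I \<Longrightarrow> c \<in> Basis \<Longrightarrow> \<bar>a i \<bullet> c\<bar> \<le> a i \<bullet> b"
    and U: "finite U" "U \<noteq> {}" and w: "\<And>u. u \<in> U \<Longrightarrow> 0 < w u"
    and r: "0 < r" and many: "(real (card I))\<^sup>2 * (1 - 1 / real r) ^ m < 1"
    and pat: "k * (m + DIM('a) * (2 * r + 1) + 1) ^ (DIM('a) - 1) < card I"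
  obtains G where "G \<subseteq> I" "card G = Suc k"
    "\<And>i l c. i \<in> G \<Longrightarrow> l \<in> G \<Longrightarrow> c \<in> Basis \<Longrightarrow>
        \<bar>(a i \<bullet> c) / (a i \<bullet> b) - (a l \<bullet> c) / (a l \<bullet> b)\<bar> \<le> 1 / real r"
    "(\<Sum>u\<in>{u\<in>U. crosses u a G}. w u) \<le> Suc k / real r * sum w U"
proof -
  \<comment> \<open>The items to be hit are the pairs that are separated by weight at least \<open>1 / r\<close>.\<close>
  define hit where "hit = (\<lambda>u (i, l). 0 < u \<bullet> a i \<and> u \<bullet> a l \<le> 0 \<or> 0 < u \<bullet> a l \<and> u \<bullet> a i \<le> 0)"
  define P where "P = {p \<in> I \<times> I. 1 / real r * sum w U \<le> (\<Sum>u\<in>{u\<in>U. hit u p}. w u)}"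
  have finP: "finite P" using I by (auto simp: P_def)
  have cP: "real (card P) \<le> (real (card I))\<^sup>2"
  proof -
    have "card P \<le> card (I \<times> I)" by (intro card_mono) (auto simp: P_def I)
    then have "real (card P) \<le> real (card (I \<times> I))" by (simp only: of_nat_le_iff)
    then show ?thesis by (simp add: card_cartesian_product power2_eq_square)
  qed
  obtain F1 where F1: "F1 \<subseteq> U" "card F1 \<le> m"
    "real (card {p\<in>P. \<forall>u\<in>F1. \<not> hit u p}) \<le> (1 - 1 / real r) ^ m * real (card P)"
    using greedy_hitting_set[OF finP U(1) _ U(2), where w = w and \<rho> = "1 / real r" and hit = hit and m = m] r w
    by (auto simp: P_def)
  have "real (card {p\<in>P. \<forall>u\<in>F1. \<not> hit u p}) < 1"
  proof -
    have "(1 - 1 / real r) ^ m * real (card P) \<le> (1 - 1 / real r) ^ m * (real (card I))\<^sup>2"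
      using r by (intro mult_left_mono cP) auto
    with F1(3) many show ?thesis by (simp add: mult.commute)
  qed
  then have "card {p\<in>P. \<forall>u\<in>F1. \<not> hit u p} = 0" by linarith
  then have "{p\<in>P. \<forall>u\<in>F1. \<not> hit u p} = {}" using finP by simp
  then have hitF1: "\<exists>u\<in>F1. hit u p" if "p \<in> P" for p
    using that by blast
  \<comment> \<open>The hyperplanes on which a chart coordinate \<open>(v \<bullet> c) / (v \<bullet> b)\<close> equals a multiple of \<open>1 / r\<close>.\<close>
  define F2 where "F2 = (\<lambda>(c, h). c - (real_of_int h / real r) *\<^sub>R b) ` (Basis \<times> {- int r..int r})"
  have fin2: "finite F2" by (auto simp: F2_def)
  have c2: "card F2 \<le> DIM('a) * (2 * r + 1)"
  proof -
    have "card F2 \<le> card ((Basis::'a set) \<times> {- int r..int r})" unfolding F2_def by (intro card_image_le) auto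
    also have "\<dots> = DIM('a) * (2 * r + 1)" by (simp add: card_cartesian_product nat_add_distrib)
    finally show ?thesis .
  qed
  define F where "F = F1 \<union> F2"
  have finF1: "finite F1" using F1(1) U(1) finite_subset by blast
  have finF: "finite F" using finF1 fin2 by (simp add: F_def)
  have cF: "card F + 1 \<le> m + DIM('a) * (2 * r + 1) + 1"
    using card_Un_le[of F1 F2] F1(2) c2 by (simp add: F_def)
  define pt where "pt = (\<lambda>v. {f\<in>F. 0 < f \<bullet> v})"
  have "card (pt ` (a ` I)) \<le> (card F + 1) ^ (DIM('a) - 1)"
    unfolding pt_def using pos finF
    by (intro card_sign_patterns_le[where e=b]) (auto simp: inner_commute)
  also have "\<dots> \<le> (m + DIM('a) * (2 * r + 1) + 1) ^ (DIM('a) - 1)" by (rule power_mono[OF cF]) simp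
  finally have "card ((\<lambda>i. pt (a i)) ` I) \<le> (m + DIM('a) * (2 * r + 1) + 1) ^ (DIM('a) - 1)"
    by (simp add: image_image)
  from pigeonhole_fibre[OF I pat this] obtain y where y: "k < card {i\<in>I. pt (a i) = y}" by blast
  then obtain G where G: "G \<subseteq> {i\<in>I. pt (a i) = y}" "card G = Suc k"
    by (meson Suc_leI obtain_subset_with_card_n)
  have same: "0 < f \<bullet> a i \<longleftrightarrow> 0 < f \<bullet> a l" if "i \<in> G" "l \<in> G" "f \<in> F" for f i l
  proof -
    have "pt (a i) = pt (a l)" using G(1) that by auto
    then show ?thesis using that(3) unfolding pt_def by blast
  qed
  have finG: "finite G" using G(1) I by (auto dest: finite_subset)
  have near: "(a l \<bullet> c) / (a l \<bullet> b) - (a i \<bullet> c) / (a i \<bullet> b) \<le> 1 / real r"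
    if il: "i \<in> G" "l \<in> G" and c: "c \<in> Basis" for i l c
  proof (rule ccontr)
    assume neg: "\<not> ?thesis"
    define x y where "x = (a i \<bullet> c) / (a i \<bullet> b)" and "y = (a l \<bullet> c) / (a l \<bullet> b)"
    have iI: "i \<in> I" "l \<in> I" using il G(1) by auto
    note pi = pos[OF iI(1)] and pl = pos[OF iI(2)]
    have x1: "- 1 \<le> x" using big[OF iI(1) c] pi unfolding x_def by (simp add: le_divide_eq)
    have y1: "y \<le> 1" using big[OF iI(2) c] pl unfolding y_def by (simp add: divide_le_eq)
    have gap: "x + 1 / r < y" using neg by (simp add: x_def y_def)
    \<comment> \<open>A grid value between the two coordinates contradicts the equality of the sign patterns.\<close>
    define h where "h = \<lceil>x * r\<rceil>"
    have h1: "x * r \<le> h" "h < x * r + 1" unfolding h_def by linarith+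
    have xh: "x \<le> h / r" using h1(1) r by (simp add: le_divide_eq)
    have "h / r < x + 1 / r" using h1(2) r by (simp add: field_simps)
    then have hy: "h / r < y" using gap by linarith
    have "h / r < 1" using hy y1 by linarith
    then have "real_of_int h < real r" using r by (simp add: divide_less_eq)
    then have hr: "h \<le> int r" by linarith
    have "- real r \<le> x * r" using x1 r by (metis mult_minus1 mult_right_mono of_nat_0_le_iff)
    then have hr': "- int r \<le> h" using h1(1) by linarith
    define f where "f = c - (real_of_int h / real r) *\<^sub>R b"
    have "f \<in> F" unfolding f_def F_def F2_def using c hr hr' by force
    moreover have "\<not> 0 < f \<bullet> a i"
    proof -
      have "f \<bullet> a i = (x - h / r) * (a i \<bullet> b)" using pi
        by (simp add: f_def x_def inner_diff_left inner_diff_right left_diff_distrib inner_commute[of _ "a i"])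
      then show ?thesis using xh pi by (simp add: mult_le_0_iff not_less)
    qed
    moreover have "0 < f \<bullet> a l"
    proof -
      have "f \<bullet> a l = (y - h / r) * (a l \<bullet> b)" using pl
        by (simp add: f_def y_def inner_diff_left inner_diff_right left_diff_distrib inner_commute[of _ "a l"])
      then show ?thesis using hy pl by simp
    qed
    ultimately show False using same il by blast
  qed
  have light: "(\<Sum>u\<in>{u\<in>U. hit u (i, l)}. w u) \<le> 1 / real r * sum w U" if "i \<in> G" "l \<in> G" for i l
  proof (rule ccontr)
    assume "\<not> ?thesis"
    then have "(i, l) \<in> P" using that G(1) by (auto simp: P_def)
    then obtain u where "u \<in> F1" "hit u (i, l)" using hitF1 by blast
    moreover have "0 < u \<bullet> a i \<longleftrightarrow> 0 < u \<bullet> a l" using same[OF that, of u] \<open>u \<in> F1\<close> unfolding F_def by blast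
    ultimately show False by (auto simp: hit_def)
  qed
  obtain i0 where i0: "i0 \<in> G" using G(2) by fastforce
  have "(\<Sum>u\<in>{u\<in>U. crosses u a G}. w u)
      \<le> (\<Sum>u\<in>{u\<in>U. crosses u a G}. \<Sum>l\<in>{l\<in>G. hit u (i0, l)}. w u)"
  proof (rule sum_mono)
    fix u assume "u \<in> {u\<in>U. crosses u a G}"
    then obtain i l where il: "u \<in> U" "i \<in> G" "l \<in> G" "0 < u \<bullet> a i" "u \<bullet> a l \<le> 0"
      by (auto simp: crosses_def)
    have "hit u (i0, i) \<or> hit u (i0, l)" using il unfolding hit_def by (simp add: linorder_not_less) linarith
    then obtain l' where "l' \<in> {l\<in>G. hit u (i0, l)}" using il by blast
    then show "w u \<le> (\<Sum>l\<in>{l\<in>G. hit u (i0, l)}. w u)"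
      using finG w[OF il(1)] by (intro member_le_sum) (auto intro: less_imp_le)
  qed
  also have "\<dots> \<le> (\<Sum>u\<in>U. \<Sum>l\<in>{l\<in>G. hit u (i0, l)}. w u)"
    using U(1) w by (intro sum_mono2 sum_nonneg) (auto intro: less_imp_le)
  also have "\<dots> = (\<Sum>l\<in>G. \<Sum>u\<in>{u\<in>U. hit u (i0, l)}. w u)"
    using U(1) finG by (rule sum.swap_restrict)
  also have "\<dots> \<le> (\<Sum>l\<in>G. 1 / real r * sum w U)" using light i0 by (intro sum_mono) auto
  also have "\<dots> = Suc k / real r * sum w U" using G(2) by simp
  finally have cross: "(\<Sum>u\<in>{u\<in>U. crosses u a G}. w u) \<le> Suc k / real r * sum w U" .
  show ?thesis
  proof (rule that[of G])
    show "G \<subseteq> I" using G(1) by auto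
    show "\<bar>(a i \<bullet> c) / (a i \<bullet> b) - (a l \<bullet> c) / (a l \<bullet> b)\<bar> \<le> 1 / real r"
      if "i \<in> G" "l \<in> G" "c \<in> Basis" for i l c
      using near[of i l c] near[of l i c] that by linarith
  qed (use G cross in auto)
qed

text \<open>Groups are chosen one at a time, and the weight of \<open>u\<close> is doubled whenever \<open>u\<close> crosses the
  chosen group. The total weight grows by a factor of at most \<open>1 + (k + 1) / r\<close> in each step, so no
  single \<open>u\<close> can cross many groups.\<close>

lemma ex_many_narrow_groups:
  fixes a :: "'i \<Rightarrow> 'a::euclidean_space"
  assumes I: "finite I" and b: "b \<in> Basis"
    and pos: "\<And>i. i \<in> I \<Longrightarrow> 0 < a i \<bullet> b"
    and big: "\<And>i c. i \<in> I \<Longrightarrow> c \<in> Basis \<Longrightarrow> \<bar>a i \<bullet> c\<bar> \<le> a i \<bullet> b"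
    and U: "finite U" "U \<noteq> {}"
    and r: "0 < r" and many: "(real (card I))\<^sup>2 * (1 - 1 / real r) ^ m < 1"
    and pat: "k * (m + DIM('a) * (2 * r + 1) + 1) ^ (DIM('a) - 1) < N0"
    and cI: "T * Suc k + N0 \<le> card I"
  shows "\<exists>G. (\<forall>\<tau><T. G \<tau> \<subseteq> I \<and> card (G \<tau>) = Suc k \<and>
      (\<forall>i\<in>G \<tau>. \<forall>l\<in>G \<tau>. \<forall>c\<in>Basis. \<bar>(a i \<bullet> c) / (a i \<bullet> b) - (a l \<bullet> c) / (a l \<bullet> b)\<bar> \<le> 1 / real r)) \<and>
      disjoint_family_on G {..<T} \<and>
      (\<Sum>u\<in>U. 2 ^ card {\<tau>\<in>{..<T}. crosses u a (G \<tau>)}) \<le> real (card U) * (1 + Suc k / real r) ^ T"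
  using cI
proof (induction T)
  case 0
  show ?case by (intro exI[of _ "\<lambda>_. {}"]) (auto simp: disjoint_family_on_def)
next
  case (Suc T)
  then obtain G where G: "\<And>\<tau>. \<tau> < T \<Longrightarrow> G \<tau> \<subseteq> I \<and> card (G \<tau>) = Suc k \<and>
      (\<forall>i\<in>G \<tau>. \<forall>l\<in>G \<tau>. \<forall>c\<in>Basis. \<bar>(a i \<bullet> c) / (a i \<bullet> b) - (a l \<bullet> c) / (a l \<bullet> b)\<bar> \<le> 1 / real r)"
     and disj: "disjoint_family_on G {..<T}"
     and wt: "(\<Sum>u\<in>U. 2 ^ card {\<tau>\<in>{..<T}. crosses u a (G \<tau>)}) \<le> real (card U) * (1 + Suc k / real r) ^ T"
    by auto
  define X where "X = (\<lambda>u. card {\<tau>\<in>{..<T}. crosses u a (G \<tau>)})"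
  define J where "J = I - (\<Union>\<tau><T. G \<tau>)"
  have "card (\<Union>\<tau><T. G \<tau>) \<le> (\<Sum>\<tau><T. card (G \<tau>))" by (rule card_UN_le) simp
  also have "\<dots> = T * Suc k" using G by simp
  finally have cG: "card (\<Union>\<tau><T. G \<tau>) \<le> T * Suc k" .
  have "finite (G \<tau>)" if "\<tau> < T" for \<tau> using G[OF that] I finite_subset by blast
  then have "finite (\<Union>\<tau><T. G \<tau>)" by blast
  from diff_card_le_card_Diff[OF this, of I] have "N0 \<le> card J"
    using Suc.prems cG unfolding J_def by simp
  then have pat': "k * (m + DIM('a) * (2 * r + 1) + 1) ^ (DIM('a) - 1) < card J" using pat by linarith
  have JI: "J \<subseteq> I" "finite J" using I by (auto simp: J_def)
  have "(real (card J))\<^sup>2 * (1 - 1 / real r) ^ m \<le> (real (card I))\<^sup>2 * (1 - 1 / real r) ^ m"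
    using r JI I by (intro mult_right_mono power_mono) (auto intro: card_mono)
  with many have many': "(real (card J))\<^sup>2 * (1 - 1 / real r) ^ m < 1" by linarith
  obtain H where H: "H \<subseteq> J" "card H = Suc k"
    "\<And>i l c. i \<in> H \<Longrightarrow> l \<in> H \<Longrightarrow> c \<in> Basis \<Longrightarrow>
        \<bar>(a i \<bullet> c) / (a i \<bullet> b) - (a l \<bullet> c) / (a l \<bullet> b)\<bar> \<le> 1 / real r"
    "(\<Sum>u\<in>{u\<in>U. crosses u a H}. 2 ^ X u) \<le> Suc k / real r * (\<Sum>u\<in>U. 2 ^ X u)"
    by (rule ex_narrow_group[OF JI(2) b _ _ U _ r many' pat', of a "\<lambda>u. 2 ^ X u"])
      (use JI pos big in auto)
  define G' where "G' = G(T := H)"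
  have X': "card {\<tau>\<in>{..<Suc T}. crosses u a (G' \<tau>)} = X u + (if crosses u a H then 1 else 0)" for u
  proof -
    have "{\<tau>\<in>{..<Suc T}. crosses u a (G' \<tau>)} =
        {\<tau>\<in>{..<T}. crosses u a (G \<tau>)} \<union> (if crosses u a H then {T} else {})"
      by (auto simp: G'_def less_Suc_eq)
    then show ?thesis by (simp add: X_def)
  qed
  have "(\<Sum>u\<in>U. 2 ^ card {\<tau>\<in>{..<Suc T}. crosses u a (G' \<tau>)}) =
      (\<Sum>u\<in>U. 2 ^ X u + (if crosses u a H then 2 ^ X u else (0::real)))"
    unfolding X' by (intro sum.cong) auto
  also have "\<dots> = (\<Sum>u\<in>U. 2 ^ X u) + (\<Sum>u\<in>{u\<in>U. crosses u a H}. 2 ^ X u)"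
    using U(1) by (simp add: sum.distrib sum.inter_filter)
  also have "\<dots> \<le> (1 + Suc k / real r) * (\<Sum>u\<in>U. 2 ^ X u)" using H(4) by (simp add: algebra_simps)
  also have "\<dots> \<le> (1 + Suc k / real r) * (real (card U) * (1 + Suc k / real r) ^ T)"
    using wt unfolding X_def by (intro mult_left_mono) auto
  finally have "(\<Sum>u\<in>U. 2 ^ card {\<tau>\<in>{..<Suc T}. crosses u a (G' \<tau>)}) \<le> real (card U) * (1 + Suc k / real r) ^ Suc T"
    by (simp add: mult_ac)
  moreover have "disjoint_family_on G' {..<Suc T}"
  proof -
    have "G \<tau> \<inter> H = {}" if "\<tau> < T" for \<tau> using H(1) that unfolding J_def by blast
    moreover have "G m \<inter> G n = {}" if "m < T" "n < T" "m \<noteq> n" for m n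
      using disj that unfolding disjoint_family_on_def by simp
    ultimately have "G' m \<inter> G' n = {}" if "m < Suc T" "n < Suc T" "m \<noteq> n" for m n
      using that unfolding G'_def
      by (cases "m = T"; cases "n = T") (simp_all add: less_Suc_eq Int_commute)
    then show ?thesis unfolding disjoint_family_on_def by simp
  qed
  moreover have "\<forall>\<tau><Suc T. G' \<tau> \<subseteq> I \<and> card (G' \<tau>) = Suc k \<and>
      (\<forall>i\<in>G' \<tau>. \<forall>l\<in>G' \<tau>. \<forall>c\<in>Basis. \<bar>(a i \<bullet> c) / (a i \<bullet> b) - (a l \<bullet> c) / (a l \<bullet> b)\<bar> \<le> 1 / real r)"
    using G H JI by (auto simp: G'_def less_Suc_eq)
  ultimately show ?case by blast
qed

section \<open>Linear relations and signs\<close>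

text \<open>The vectors are indexed rather than collected in a set, so repetitions are allowed; a repetition
  is itself a relation. With maximal modulus one, \<open>1 + c i\<close> and \<open>1 - c i\<close> are never negative, and one
  of them vanishes for some \<open>i\<close>.\<close>

lemma ex_linear_relation:
  fixes a :: "'i \<Rightarrow> 'a::euclidean_space"
  assumes G: "finite G" "DIM('a) < card G"
  shows "\<exists>c. (\<Sum>i\<in>G. c i *\<^sub>R a i) = 0 \<and> (\<forall>i. \<bar>c i\<bar> \<le> 1) \<and> (\<forall>i. i \<notin> G \<longrightarrow> c i = 0) \<and> (\<exists>i\<in>G. \<bar>c i\<bar> = (1::real))"
proof -
  have "\<exists>c. (\<Sum>i\<in>G. c i *\<^sub>R a i) = 0 \<and> (\<exists>i\<in>G. c i \<noteq> (0::real))"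
  proof (cases "inj_on a G")
    case True
    then have "DIM('a) < card (a ` G)" using G by (simp add: card_image)
    then have "dependent (a ` G)" using G(1) by (intro dependent_biggerset) auto
    then obtain d where d: "(\<Sum>v\<in>a ` G. d v *\<^sub>R v) = 0" "\<exists>v\<in>a ` G. d v \<noteq> 0"
      using G(1) by (subst (asm) dependent_finite) auto
    have "(\<Sum>i\<in>G. d (a i) *\<^sub>R a i) = 0" using d(1) True by (simp add: sum.reindex)
    with d(2) show ?thesis by (intro exI[of _ "\<lambda>i. d (a i)"]) auto
  next
    case False
    then obtain i l where il: "i \<in> G" "l \<in> G" "i \<noteq> l" "a i = a l" by (auto simp: inj_on_def)
    define c where "c = (\<lambda>x. if x = i then 1 else if x = l then - 1 else (0::real))"
    have "(\<Sum>x\<in>G. c x *\<^sub>R a x) = (\<Sum>x\<in>{i, l}. c x *\<^sub>R a x)"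
      using il G(1) by (intro sum.mono_neutral_right) (auto simp: c_def)
    also have "\<dots> = 0" using il by (simp add: c_def)
    finally show ?thesis using il(1) by (intro exI[of _ c]) (auto simp: c_def)
  qed
  then obtain c where c: "(\<Sum>i\<in>G. c i *\<^sub>R a i) = 0" "\<exists>i\<in>G. c i \<noteq> (0::real)" by blast
  define m where "m = Max ((\<lambda>i. \<bar>c i\<bar>) ` G)"
  have mge: "\<bar>c i\<bar> \<le> m" if "i \<in> G" for i unfolding m_def using that G(1) by (intro Max_ge) auto
  have "m > 0" using c(2) mge by fastforce
  have "m \<in> (\<lambda>i. \<bar>c i\<bar>) ` G" unfolding m_def using G by (intro Max_in) auto
  then obtain i0 where i0: "i0 \<in> G" "\<bar>c i0\<bar> = m" by auto
  define d where "d = (\<lambda>i. if i \<in> G then c i / m else 0)"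
  have "(\<Sum>i\<in>G. d i *\<^sub>R a i) = (\<Sum>i\<in>G. (1 / m) *\<^sub>R (c i *\<^sub>R a i))"
    by (intro sum.cong) (auto simp: d_def)
  also have "\<dots> = 0" using c(1) by (simp only: scaleR_sum_right[symmetric] scaleR_zero_right)
  finally have "(\<Sum>i\<in>G. d i *\<^sub>R a i) = 0" .
  moreover have "\<bar>d i\<bar> \<le> 1" for i using mge[of i] \<open>m > 0\<close> by (auto simp: d_def)
  moreover have "\<bar>d i0\<bar> = 1" using i0 \<open>m > 0\<close> by (simp add: d_def)
  ultimately show ?thesis using i0(1) by (intro exI[of _ d]) (auto simp: d_def)
qed

text \<open>Termwise comparison of the two power series, by \<open>2 ^ k * fact k \<le> fact (2 * k)\<close>.\<close>

lemma cosh_le_exp_half_square: "cosh (x::real) \<le> exp (x\<^sup>2 / 2)"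
proof -
  have fact_le: "(2::real) ^ k * fact k \<le> fact (2 * k)" for k
  proof (induction k)
    case (Suc k)
    have "(2::real) ^ Suc k * fact (Suc k) = (2 * real k + 2) * (2 ^ k * fact k)"
      by (simp add: field_simps)
    also have "\<dots> \<le> (2 * real k + 2) * fact (2 * k)" using Suc by (intro mult_left_mono) auto
    also have "\<dots> \<le> (2 * real k + 2) * ((2 * real k + 1) * fact (2 * k))"
    proof -
      have "(1::real) * fact (2 * k) \<le> (2 * real k + 1) * fact (2 * k)" by (intro mult_right_mono) auto
      then show ?thesis by (intro mult_left_mono) auto
    qed
    also have "\<dots> = fact (2 * Suc k)" by (simp add: algebra_simps)
    finally show ?case .
  qed simp
  have ev: "(\<lambda>n. if even n then x ^ n /\<^sub>R fact n else 0) sums cosh x" using cosh_converges[of x] .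
  have "(\<lambda>k. (x ^ (2 * k)) /\<^sub>R fact (2 * k)) sums cosh x"
  proof -
    have "(\<lambda>k. (\<lambda>n. if even n then x ^ n /\<^sub>R fact n else 0) (2 * k)) sums cosh x"
      by (rule iffD2[OF sums_mono_reindex ev]) (auto simp: strict_mono_def elim: oddE evenE)
    then show ?thesis by simp
  qed
  moreover have "(\<lambda>k. (x\<^sup>2 / 2) ^ k /\<^sub>R fact k) sums exp (x\<^sup>2 / 2)" by (rule exp_converges)
  moreover have "(x ^ (2 * k)) /\<^sub>R fact (2 * k) \<le> (x\<^sup>2 / 2) ^ k /\<^sub>R fact k" for k
  proof -
    have "x ^ (2 * k) / fact (2 * k) \<le> x ^ (2 * k) / (2 ^ k * fact k)"
      by (rule divide_left_mono[OF fact_le zero_le_even_power'])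
         (intro mult_pos_pos fact_gt_zero zero_less_power zero_less_numeral)
    also have "\<dots> = (x\<^sup>2 / 2) ^ k / fact k" by (simp add: power_mult power_divide)
    finally show ?thesis by (simp only: real_scaleR_def divide_inverse mult.commute)
  qed
  ultimately show ?thesis by (rule sums_le[rotated 1]) 
qed

text \<open>The method of conditional expectations: averaging \<open>cosh (g + e)\<close> and \<open>cosh (g - e)\<close> gives
  \<open>cosh g * cosh e\<close>, so one of the two signs does not exceed the average.\<close>

lemma ex_signs_cosh:
  fixes e :: "nat \<Rightarrow> 'u \<Rightarrow> real"
  assumes "\<And>u. u \<in> U \<Longrightarrow> 0 \<le> p u"
  shows "\<exists>s. (\<forall>\<tau>. s \<tau> \<in> {-1, 1}) \<and>
    (\<Sum>u\<in>U. p u * cosh (\<Sum>\<tau><T. s \<tau> * e \<tau> u)) \<le> (\<Sum>u\<in>U. p u * (\<Prod>\<tau><T. cosh (e \<tau> u)))"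
  using assms
proof (induction T arbitrary: p)
  case 0
  then show ?case by (intro exI[of _ "\<lambda>_. 1"]) auto
next
  case (Suc T)
  obtain s where s: "\<And>\<tau>. s \<tau> \<in> {-1, 1}" and
    le: "(\<Sum>u\<in>U. (p u * cosh (e T u)) * cosh (\<Sum>\<tau><T. s \<tau> * e \<tau> u))
      \<le> (\<Sum>u\<in>U. (p u * cosh (e T u)) * (\<Prod>\<tau><T. cosh (e \<tau> u)))"
    using Suc.IH[of "\<lambda>u. p u * cosh (e T u)"] Suc.prems by (auto simp: cosh_real_nonneg)
  define g where "g = (\<lambda>u. \<Sum>\<tau><T. s \<tau> * e \<tau> u)"
  define A where "A = (\<lambda>\<sigma>. \<Sum>u\<in>U. p u * cosh (g u + \<sigma> * e T u))"
  have "A 1 + A (-1) = (\<Sum>u\<in>U. 2 * (p u * cosh (e T u) * cosh (g u)))"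
    unfolding A_def sum.distrib[symmetric]
    by (intro sum.cong refl) (simp add: cosh_add cosh_diff algebra_simps)
  then have AA: "A 1 + A (-1) = 2 * (\<Sum>u\<in>U. p u * cosh (e T u) * cosh (g u))"
    by (simp only: sum_distrib_left)
  obtain \<sigma> where \<sigma>: "\<sigma> \<in> {-1, 1}" "A \<sigma> \<le> (\<Sum>u\<in>U. p u * cosh (e T u) * cosh (g u))"
    using AA by (cases "A 1 \<le> A (-1)") force+
  define s' where "s' = s(T := \<sigma>)"
  have "(\<Sum>u\<in>U. p u * cosh (\<Sum>\<tau><Suc T. s' \<tau> * e \<tau> u)) = A \<sigma>"
    unfolding A_def g_def s'_def by (intro sum.cong refl arg_cong2[where f="(*)"] arg_cong[where f=cosh]) auto
  also have "\<dots> \<le> (\<Sum>u\<in>U. (p u * cosh (e T u)) * (\<Prod>\<tau><T. cosh (e \<tau> u)))"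
    using \<sigma>(2) le unfolding g_def by linarith
  also have "\<dots> = (\<Sum>u\<in>U. p u * (\<Prod>\<tau><Suc T. cosh (e \<tau> u)))" by (simp add: mult_ac)
  finally show ?case using s \<sigma>(1) by (intro exI[of _ s']) (auto simp: s'_def)
qed

text \<open>A union bound over \<open>U\<close> for sums of random signs: if at most \<open>X\<close> of the terms are nonzero at each
  point, then the sum is of size \<open>sqrt X\<close> and not \<open>X\<close>, up to the logarithm of the number of points.\<close>

lemma ex_signs_small_sum:
  fixes e :: "nat \<Rightarrow> 'u \<Rightarrow> real"
  assumes U: "finite U" "U \<noteq> {}" and \<beta>: "0 < \<beta>" and X: "0 < X"
    and e: "\<And>\<tau> u. \<tau> < T \<Longrightarrow> u \<in> U \<Longrightarrow> \<bar>e \<tau> u\<bar> \<le> \<beta>"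
    and supp: "\<And>u. u \<in> U \<Longrightarrow> real (card {\<tau>\<in>{..<T}. e \<tau> u \<noteq> 0}) \<le> X"
  shows "\<exists>s. (\<forall>\<tau>. s \<tau> \<in> {-1, 1}) \<and>
    (\<forall>u\<in>U. \<bar>\<Sum>\<tau><T. s \<tau> * e \<tau> u\<bar> \<le> \<beta> * sqrt X * (ln (2 * card U) + 1 / 2))"
proof -
  \<comment> \<open>The scale that turns the product of hyperbolic cosines into a constant.\<close>
  define \<kappa> where "\<kappa> = 1 / (\<beta> * sqrt X)"
  have \<kappa>: "\<kappa> > 0" "(\<kappa> * \<beta>)\<^sup>2 = 1 / X" using \<beta> X by (simp_all add: \<kappa>_def power_divide power_mult_distrib)
  obtain s where s: "\<And>\<tau>. s \<tau> \<in> {-1, 1}" and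
    le: "(\<Sum>u\<in>U. cosh (\<Sum>\<tau><T. s \<tau> * (\<kappa> * e \<tau> u))) \<le> (\<Sum>u\<in>U. \<Prod>\<tau><T. cosh (\<kappa> * e \<tau> u))"
    using ex_signs_cosh[where U = U and p = "\<lambda>_. 1" and T = T and e = "\<lambda>\<tau> u. \<kappa> * e \<tau> u"] by auto
  have prod: "(\<Prod>\<tau><T. cosh (\<kappa> * e \<tau> u)) \<le> exp (1 / 2)" if u: "u \<in> U" for u
  proof -
    let ?C = "{\<tau>\<in>{..<T}. e \<tau> u \<noteq> 0}"
    have "(\<Prod>\<tau><T. cosh (\<kappa> * e \<tau> u)) = (\<Prod>\<tau>\<in>?C. cosh (\<kappa> * e \<tau> u))"
      by (intro prod.mono_neutral_right) auto
    also have "\<dots> \<le> (\<Prod>\<tau>\<in>?C. exp (1 / (2 * X)))"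
    proof (intro prod_mono conjI)
      fix \<tau> assume "\<tau> \<in> ?C"
      then have "\<bar>\<kappa> * e \<tau> u\<bar> \<le> \<kappa> * \<beta>" using e u \<kappa>(1) by (simp add: abs_mult)
      then have "(\<kappa> * e \<tau> u)\<^sup>2 \<le> (\<kappa> * \<beta>)\<^sup>2" by (metis abs_ge_zero power2_abs power_mono)
      then have "(\<kappa> * e \<tau> u)\<^sup>2 / 2 \<le> 1 / (2 * X)" using \<kappa>(2) by simp
      then show "cosh (\<kappa> * e \<tau> u) \<le> exp (1 / (2 * X))"
        using cosh_le_exp_half_square[of "\<kappa> * e \<tau> u"] by (meson exp_le_cancel_iff order_trans)
    qed (auto intro: order_trans[OF _ cosh_real_ge_1])
    also have "\<dots> = exp (card ?C * (1 / (2 * X)))" by (simp only: prod_constant exp_of_nat_mult)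
    also have "\<dots> \<le> exp (X * (1 / (2 * X)))"
      using supp[OF u] X by (intro exp_le_cancel_iff[THEN iffD2] mult_right_mono) auto
    finally show ?thesis using X by simp
  qed
  have "\<bar>\<Sum>\<tau><T. s \<tau> * e \<tau> u\<bar> \<le> \<beta> * sqrt X * (ln (2 * card U) + 1 / 2)" if u: "u \<in> U" for u
  proof -
    define g where "g = (\<Sum>\<tau><T. s \<tau> * e \<tau> u)"
    have cU: "0 < card U" using U by (simp add: card_gt_0_iff)
    have "exp \<bar>\<kappa> * g\<bar> / 2 \<le> cosh \<bar>\<kappa> * g\<bar>" by (simp add: cosh_def)
    also have "\<dots> = cosh (\<Sum>\<tau><T. s \<tau> * (\<kappa> * e \<tau> u))"
      by (simp add: g_def sum_distrib_left mult_ac cosh_real_abs)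
    also have "\<dots> \<le> (\<Sum>u\<in>U. cosh (\<Sum>\<tau><T. s \<tau> * (\<kappa> * e \<tau> u)))"
      using U u by (intro member_le_sum) (auto intro: order_trans[OF _ cosh_real_ge_1])
    also have "\<dots> \<le> (\<Sum>u\<in>U. exp (1 / 2))" using le prod by (meson order_trans sum_mono)
    also have "\<dots> = card U * exp (1 / 2)" by simp
    finally have "exp \<bar>\<kappa> * g\<bar> \<le> 2 * card U * exp (1 / 2)" by simp
    also have "\<dots> = exp (ln (2 * card U) + 1 / 2)" using cU by (simp add: exp_add)
    finally have "\<kappa> * \<bar>g\<bar> \<le> ln (2 * card U) + 1 / 2" using \<kappa>(1) by (simp add: abs_mult)
    then show ?thesis unfolding g_def[symmetric] \<kappa>_def using \<beta> X by (simp add: field_simps)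
  qed
  with s show ?thesis by blast
qed

section \<open>Reducing the number of segments\<close>

text \<open>The support function of the zonotope that is the sum of the segments from \<open>- x\<close> to \<open>x\<close>.\<close>

definition segment_sum :: "'a::euclidean_space list \<Rightarrow> 'a \<Rightarrow> real" where
  "segment_sum xs u = (\<Sum>x\<leftarrow>xs. \<bar>u \<bullet> x\<bar>)"

text \<open>Size is measured by the maximum norm, because inside a chart this norm is a linear function.\<close>

definition total_size :: "'a::euclidean_space list \<Rightarrow> real" where
  "total_size xs = (\<Sum>x\<leftarrow>xs. infnorm x)"

lemma abs_inner_le_infnorm:
  fixes x :: "'a::euclidean_space"
  assumes "c \<in> Basis" shows "\<bar>x \<bullet> c\<bar> \<le> infnorm x"
  using Basis_le_infnorm[OF assms, of x] .

lemma infnorm_attained: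
  fixes x :: "'a::euclidean_space"
  shows "\<exists>c\<in>Basis. \<bar>x \<bullet> c\<bar> = infnorm x"
proof -
  have "Max ((\<lambda>i. \<bar>x \<bullet> i\<bar>) ` Basis) \<in> (\<lambda>i. \<bar>x \<bullet> i\<bar>) ` Basis" by (intro Max_in) auto
  then obtain c where "Max ((\<lambda>i. \<bar>x \<bullet> i\<bar>) ` Basis) = \<bar>x \<bullet> c\<bar>" "c \<in> Basis" by (rule imageE)
  then show ?thesis by (intro bexI[of _ c]) (simp_all add: infnorm_Max)
qed

lemma sum_list_eq_sum_nth: "(\<Sum>x\<leftarrow>xs. f x) = (\<Sum>i<length xs. f (xs ! i))"
  by (simp add: sum_list_sum_nth atLeast0LessThan)

lemma sum_list_filter_map_upt:
  fixes f :: "'b \<Rightarrow> real"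
  assumes "\<And>y. \<not> P y \<Longrightarrow> f y = 0"
  shows "(\<Sum>y\<leftarrow>filter P (map g [0..<N]). f y) = (\<Sum>i<N. f (g i))"
proof -
  have "(\<Sum>y\<leftarrow>filter P (map g [0..<N]). f y) = (\<Sum>y\<leftarrow>map g [0..<N]. f y)"
    using assms by (intro sum_list_map_filter) auto
  also have "\<dots> = (\<Sum>i<N. f (g i))" by (simp add: sum_list_eq_sum_nth)
  finally show ?thesis .
qed

text \<open>A perturbation along a linear relation changes nothing in directions that do not cross the
  group, since there \<open>\<bar>u \<bullet> a i\<bar>\<close> is linear in \<open>a i\<close>. In a direction that crosses the group, \<open>u\<close>
  changes sign on a chart set of width \<open>1 / r\<close>, and hence is itself small there.\<close>

lemma narrow_group_error:
  fixes a :: "'i \<Rightarrow> 'a::euclidean_space"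
  assumes G: "card G = k" and b: "b \<in> Basis"
    and pos: "\<And>i. i \<in> G \<Longrightarrow> 0 < a i \<bullet> b" and cap: "\<And>i. i \<in> G \<Longrightarrow> a i \<bullet> b \<le> L"
    and near: "\<And>i l c. i \<in> G \<Longrightarrow> l \<in> G \<Longrightarrow> c \<in> Basis \<Longrightarrow>
        \<bar>(a i \<bullet> c) / (a i \<bullet> b) - (a l \<bullet> c) / (a l \<bullet> b)\<bar> \<le> 1 / real r"
    and C: "\<And>i. \<bar>C i\<bar> \<le> 1" "(\<Sum>i\<in>G. C i *\<^sub>R a i) = 0"
    and u: "\<And>c. c \<in> Basis \<Longrightarrow> \<bar>u \<bullet> c\<bar> \<le> 1"
  shows "(\<Sum>i\<in>G. C i * \<bar>u \<bullet> a i\<bar>) \<noteq> 0 \<Longrightarrow> crosses u a G"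
    and "\<bar>\<Sum>i\<in>G. C i * \<bar>u \<bullet> a i\<bar>\<bar> \<le> k * (L * (DIM('a) / r))"
proof -
  have zero: "(\<Sum>i\<in>G. C i * \<bar>u \<bullet> a i\<bar>) = 0" if nc: "\<not> crosses u a G"
  proof -
    have "\<exists>\<sigma>. \<forall>i\<in>G. \<bar>u \<bullet> a i\<bar> = \<sigma> * (u \<bullet> a i)"
    proof (cases "\<exists>i\<in>G. 0 < u \<bullet> a i")
      case True
      then have "\<forall>l\<in>G. 0 < u \<bullet> a l" using nc by (auto simp: crosses_def not_le)
      then show ?thesis by (intro exI[of _ 1]) auto
    next
      case False
      then show ?thesis by (intro exI[of _ "- 1"]) (auto simp: not_less)
    qed
    then obtain \<sigma> where "\<And>i. i \<in> G \<Longrightarrow> \<bar>u \<bullet> a i\<bar> = \<sigma> * (u \<bullet> a i)" by blast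
    then have "(\<Sum>i\<in>G. C i * \<bar>u \<bullet> a i\<bar>) = (\<Sum>i\<in>G. \<sigma> * (u \<bullet> (C i *\<^sub>R a i)))"
      by (intro sum.cong) auto
    also have "\<dots> = \<sigma> * (u \<bullet> (\<Sum>i\<in>G. C i *\<^sub>R a i))"
      by (simp only: inner_sum_right sum_distrib_left)
    finally show ?thesis using C(2) by simp
  qed
  then show "(\<Sum>i\<in>G. C i * \<bar>u \<bullet> a i\<bar>) \<noteq> 0 \<Longrightarrow> crosses u a G" by blast
  have l0: "0 \<le> k * (L * (DIM('a) / r))"
  proof (cases "G = {}")
    case True then show ?thesis using G by simp
  next
    case False
    then have "0 \<le> L" using pos cap by (meson all_not_in_conv less_eq_real_def order.trans)
    then show ?thesis by simp
  qed
  show "\<bar>\<Sum>i\<in>G. C i * \<bar>u \<bullet> a i\<bar>\<bar> \<le> k * (L * (DIM('a) / r))"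
  proof (cases "crosses u a G")
    case False
    then show ?thesis using zero l0 by simp
  next
    case True
    have ub: "\<bar>u \<bullet> a i\<bar> \<le> L * (DIM('a) / r)" if i: "i \<in> G" for i
    proof -
      define y where "y = (\<lambda>l. u \<bullet> a l / (a l \<bullet> b))"
      obtain l where l: "l \<in> G" "y i * y l \<le> 0"
      proof -
        obtain p q where pq: "p \<in> G" "q \<in> G" "0 < u \<bullet> a p" "u \<bullet> a q \<le> 0"
          using True by (auto simp: crosses_def)
        have yp: "0 \<le> y p" "y q \<le> 0" using pq pos[OF pq(1)] pos[OF pq(2)] by (simp_all add: y_def divide_le_0_iff)
        show ?thesis
        proof (cases "0 \<le> y i")
          case True then show ?thesis using that[of q] pq(2) yp by (simp add: mult_nonneg_nonpos)
        next
          case False then show ?thesis using that[of p] pq(1) yp by (simp add: mult_nonpos_nonneg)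
        qed
      qed
      have "\<bar>y i\<bar> \<le> \<bar>y i - y l\<bar>" using l(2) by (auto simp: mult_le_0_iff abs_if)
      also have "y i - y l = (\<Sum>c\<in>Basis. (u \<bullet> c) * ((a i \<bullet> c) / (a i \<bullet> b) - (a l \<bullet> c) / (a l \<bullet> b)))"
        unfolding y_def
        by (subst (1 2) euclidean_inner[of u])
           (simp add: sum_divide_distrib right_diff_distrib sum_subtractf)
      also have "\<bar>\<dots>\<bar> \<le> (\<Sum>c\<in>(Basis::'a set). 1 * (1 / real r))"
      proof (rule order.trans[OF sum_abs sum_mono])
        fix c :: 'a assume c: "c \<in> Basis"
        show "\<bar>(u \<bullet> c) * ((a i \<bullet> c) / (a i \<bullet> b) - (a l \<bullet> c) / (a l \<bullet> b))\<bar> \<le> 1 * (1 / real r)"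
          unfolding abs_mult using u[OF c] near[OF i l(1) c] by (intro mult_mono) auto
      qed
      also have "\<dots> = DIM('a) / r" by simp
      finally have yi: "\<bar>y i\<bar> \<le> DIM('a) / r" .
      have "\<bar>u \<bullet> a i\<bar> = (a i \<bullet> b) * \<bar>y i\<bar>" using pos[OF i] by (simp add: y_def abs_mult)
      also have "\<dots> \<le> L * (DIM('a) / r)"
        using yi cap[OF i] pos[OF i] by (intro mult_mono) auto
      finally show ?thesis .
    qed
    have "\<bar>C i * \<bar>u \<bullet> a i\<bar>\<bar> \<le> 1 * (L * (DIM('a) / r))" if "i \<in> G" for i
      unfolding abs_mult abs_abs by (rule mult_mono[OF C(1) ub[OF that]]) auto
    then have "\<bar>\<Sum>i\<in>G. C i * \<bar>u \<bullet> a i\<bar>\<bar> \<le> (\<Sum>i\<in>G. 1 * (L * (DIM('a) / r)))"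
      by (rule order.trans[OF sum_abs sum_mono])
    also have "\<dots> = k * (L * (DIM('a) / r))" using G by simp
    finally show ?thesis .
  qed
qed

text \<open>One reduction step. In each narrow group the lengths are changed by the factors
  \<open>1 + s * C i\<close>, where \<open>C\<close> is a linear relation of maximal modulus one and \<open>s\<close> a sign. Some coefficient
  has modulus one, so one of the two signs deletes a segment of the group; replacing the whole
  sign vector by its negative if necessary, at least half of the groups lose a segment. The total
  size is preserved, because in a chart the size of a vector is a coordinate, thus linear.\<close>

lemma ex_fewer_segments:
  fixes xs :: "'a::euclidean_space list"
  defines "n \<equiv> DIM('a)"
  assumes nz: "0 \<notin> set xs" and cap: "\<And>x. x \<in> set xs \<Longrightarrow> infnorm x \<le> L" and L: "0 < L"
    and U: "finite U" "U \<noteq> {}" "\<And>u c. u \<in> U \<Longrightarrow> c \<in> Basis \<Longrightarrow> \<bar>u \<bullet> c\<bar> \<le> 1"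
    and r: "0 < r" and T: "0 < T" and many: "(real (length xs))\<^sup>2 * (1 - 1 / real r) ^ m < 1"
    and pat: "n * (m + n * (2 * r + 1) + 1) ^ (n - 1) < N0"
    and len: "n * (T * Suc n + N0) \<le> length xs"
  shows "\<exists>ys. total_size ys = total_size xs \<and>
    2 * length ys + T \<le> 2 * length xs \<and>
    (\<forall>u\<in>U. \<bar>segment_sum xs u - segment_sum ys u\<bar> \<le> Suc n * (L * (n / r)) *
       sqrt ((ln (card U) + T * Suc n / r) / ln 2) * (ln (2 * card U) + 1 / 2))"
proof -
  define N where "N = length xs"
  define \<beta> where "\<beta> = (\<lambda>i. SOME c. c \<in> Basis \<and> \<bar>xs ! i \<bullet> c\<bar> = infnorm (xs ! i))"
  have \<beta>: "\<beta> i \<in> Basis" "\<bar>xs ! i \<bullet> \<beta> i\<bar> = infnorm (xs ! i)" for i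
    using someI_ex[of "\<lambda>c. c \<in> Basis \<and> \<bar>xs ! i \<bullet> c\<bar> = infnorm (xs ! i)"] infnorm_attained[of "xs ! i"]
    unfolding \<beta>_def by blast+
  \<comment> \<open>The vector \<open>a i\<close> is \<open>xs ! i\<close> or its negative, oriented so that its coordinate of largest modulus is positive.\<close>
  define a where "a = (\<lambda>i. sgn (xs ! i \<bullet> \<beta> i) *\<^sub>R (xs ! i))"
  have ip: "0 < infnorm (xs ! i)" if "i < N" for i
    using nz that nth_mem[of i xs] unfolding N_def by (metis infnorm_pos_lt)
  have ab: "a i \<bullet> \<beta> i = infnorm (xs ! i)" for i
    using \<beta>(2)[of i] by (simp add: a_def abs_sgn mult.commute)
  have abs_a: "\<bar>v \<bullet> a i\<bar> = \<bar>v \<bullet> xs ! i\<bar>" if "i < N" for i v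
  proof -
    have "xs ! i \<bullet> \<beta> i \<noteq> 0" using \<beta>(2)[of i] ip[OF that] by auto
    then have "\<bar>sgn (xs ! i \<bullet> \<beta> i)\<bar> = 1" by (simp add: abs_sgn_eq)
    then show ?thesis by (simp add: a_def abs_mult)
  qed
  have "(T * Suc n + N0 - 1) * n < card {..<N}"
  proof -
    have "n * (T * Suc n + N0 - 1) < n * (T * Suc n + N0)" using pat unfolding n_def by simp
    then have "n * (T * Suc n + N0 - 1) < N" using len unfolding N_def by (rule order.strict_trans2)
    then show ?thesis by (simp only: card_lessThan mult.commute)
  qed
  moreover have "card (\<beta> ` {..<N}) \<le> n" unfolding n_def using \<beta>(1) by (intro card_mono) auto
  ultimately obtain b where b: "T * Suc n + N0 - 1 < card {i\<in>{..<N}. \<beta> i = b}"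
    using pigeonhole_fibre[of "{..<N}" "T * Suc n + N0 - 1" n \<beta>] by auto
  define I where "I = {i\<in>{..<N}. \<beta> i = b}"
  have finI: "finite I" and IN: "I \<subseteq> {..<N}" by (auto simp: I_def)
  have "card I \<noteq> 0" using b unfolding I_def by linarith
  then have "I \<noteq> {}" by auto
  then have bB: "b \<in> Basis" using \<beta>(1) by (auto simp: I_def)
  have Iab: "a i \<bullet> b = infnorm (xs ! i)" if "i \<in> I" for i using that ab[of i] by (auto simp: I_def)
  have Ipos: "0 < a i \<bullet> b" if "i \<in> I" for i using Iab[OF that] ip[of i] that by (auto simp: I_def)
  have Ibig: "\<bar>a i \<bullet> c\<bar> \<le> a i \<bullet> b" if "i \<in> I" "c \<in> Basis" for i c
  proof -
    have "i < N" using that IN by auto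
    from abs_a[OF this, of c] show ?thesis
      using abs_inner_le_infnorm[OF that(2), of "xs ! i"] Iab[OF that(1)] by (simp add: inner_commute)
  qed
  have Icap: "a i \<bullet> b \<le> L" if "i \<in> I" for i
    using Iab[OF that] cap[of "xs ! i"] that nth_mem[of i xs] by (auto simp: I_def N_def)
  have "card I \<le> N" using card_mono[OF _ IN] by simp
  then have "(real (card I))\<^sup>2 * (1 - 1 / real r) ^ m \<le> (real N)\<^sup>2 * (1 - 1 / real r) ^ m"
    using r by (intro mult_right_mono power_mono) auto
  then have many': "(real (card I))\<^sup>2 * (1 - 1 / real r) ^ m < 1" using many by (simp add: N_def)
  have cI: "T * Suc n + N0 \<le> card I" using b unfolding I_def by linarith
  from ex_many_narrow_groups[where a = a, OF finI bB Ipos Ibig U(1,2) r many' pat[unfolded n_def] cI[unfolded n_def]]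
  obtain G where GG: "(\<forall>\<tau><T. G \<tau> \<subseteq> I \<and> card (G \<tau>) = Suc n \<and>
      (\<forall>i\<in>G \<tau>. \<forall>l\<in>G \<tau>. \<forall>c\<in>Basis. \<bar>(a i \<bullet> c) / (a i \<bullet> b) - (a l \<bullet> c) / (a l \<bullet> b)\<bar> \<le> 1 / real r)) \<and>
      disjoint_family_on G {..<T} \<and>
      (\<Sum>u\<in>U. 2 ^ card {\<tau>\<in>{..<T}. crosses u a (G \<tau>)}) \<le> real (card U) * (1 + Suc n / real r) ^ T"
    unfolding n_def by (rule exE)
  have G: "G \<tau> \<subseteq> I \<and> card (G \<tau>) = Suc n \<and>
      (\<forall>i\<in>G \<tau>. \<forall>l\<in>G \<tau>. \<forall>c\<in>Basis. \<bar>(a i \<bullet> c) / (a i \<bullet> b) - (a l \<bullet> c) / (a l \<bullet> b)\<bar> \<le> 1 / real r)"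
    if "\<tau> < T" for \<tau> using GG that by simp
  have disj: "disjoint_family_on G {..<T}"
    and wt: "(\<Sum>u\<in>U. 2 ^ card {\<tau>\<in>{..<T}. crosses u a (G \<tau>)}) \<le> real (card U) * (1 + Suc n / real r) ^ T"
    using GG by simp_all
  have finG: "finite (G \<tau>)" if "\<tau> < T" for \<tau> using G[OF that] finI finite_subset by blast
  have "\<exists>c. (\<Sum>i\<in>G \<tau>. c i *\<^sub>R a i) = 0 \<and> (\<forall>i. \<bar>c i\<bar> \<le> 1) \<and> (\<forall>i. i \<notin> G \<tau> \<longrightarrow> c i = 0) \<and>
      (\<exists>i\<in>G \<tau>. \<bar>c i\<bar> = (1::real))" if "\<tau> < T" for \<tau>
    using ex_linear_relation[OF finG[OF that], of a] G[OF that] by (simp add: n_def)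
  then obtain C where C: "\<And>\<tau>. \<tau> < T \<Longrightarrow> (\<Sum>i\<in>G \<tau>. C \<tau> i *\<^sub>R a i) = 0 \<and> (\<forall>i. \<bar>C \<tau> i\<bar> \<le> 1) \<and>
      (\<forall>i. i \<notin> G \<tau> \<longrightarrow> C \<tau> i = 0) \<and> (\<exists>i\<in>G \<tau>. \<bar>C \<tau> i\<bar> = (1::real))" by metis
  define e where "e = (\<lambda>\<tau> u. \<Sum>i\<in>G \<tau>. C \<tau> i * \<bar>u \<bullet> a i\<bar>)"
  define E where "E = Suc n * (L * (n / r))"
  define X where "X = (ln (card U) + T * Suc n / r) / ln 2"
  have cU: "1 \<le> card U" using U by (simp add: Suc_le_eq card_gt_0_iff)
  have "E > 0" using L r by (simp add: E_def n_def)
  have "X > 0" using cU T r unfolding X_def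
    by (intro divide_pos_pos add_nonneg_pos mult_pos_pos) (auto intro: ln_ge_zero add_pos_nonneg)
  have ebound: "\<bar>e \<tau> u\<bar> \<le> E" and esupp: "e \<tau> u \<noteq> 0 \<Longrightarrow> crosses u a (G \<tau>)" if "\<tau> < T" "u \<in> U" for \<tau> u
  proof -
    have sub: "i \<in> I" if "i \<in> G \<tau>" for i using G[OF \<open>\<tau> < T\<close>] that by blast
    have G': "card (G \<tau>) = Suc n"
      "\<And>i l c. i \<in> G \<tau> \<Longrightarrow> l \<in> G \<tau> \<Longrightarrow> c \<in> Basis \<Longrightarrow>
        \<bar>(a i \<bullet> c) / (a i \<bullet> b) - (a l \<bullet> c) / (a l \<bullet> b)\<bar> \<le> 1 / real r"
      using G[OF that(1)] by blast+
    have C': "\<And>i. \<bar>C \<tau> i\<bar> \<le> 1" "(\<Sum>i\<in>G \<tau>. C \<tau> i *\<^sub>R a i) = 0" using C[OF that(1)] by blast+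
    note narrow = narrow_group_error[where G = "G \<tau>" and k = "Suc n" and a = a and b = b and L = L
        and r = r and C = "C \<tau>" and u = u,
        OF G'(1) bB Ipos[OF sub] Icap[OF sub] G'(2) C' U(3)[OF that(2)]]
    show "\<bar>e \<tau> u\<bar> \<le> E" unfolding e_def E_def n_def by (rule narrow(2)[unfolded n_def])
    show "e \<tau> u \<noteq> 0 \<Longrightarrow> crosses u a (G \<tau>)" unfolding e_def by (rule narrow(1))
  qed
  have supp: "real (card {\<tau>\<in>{..<T}. e \<tau> u \<noteq> 0}) \<le> X" if u: "u \<in> U" for u
  proof -
    define Y where "Y = card {\<tau>\<in>{..<T}. crosses u a (G \<tau>)}"
    have "card {\<tau>\<in>{..<T}. e \<tau> u \<noteq> 0} \<le> Y"
      unfolding Y_def using esupp u by (intro card_mono) auto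
    moreover have "real Y \<le> X"
    proof -
      have "(2::real) ^ Y \<le> (\<Sum>u\<in>U. 2 ^ card {\<tau>\<in>{..<T}. crosses u a (G \<tau>)})"
        unfolding Y_def using U(1) u by (intro member_le_sum) auto
      also have "\<dots> \<le> real (card U) * (1 + Suc n / real r) ^ T" by (rule wt)
      also have "\<dots> \<le> real (card U) * exp (Suc n / real r) ^ T"
        by (intro mult_left_mono power_mono exp_ge_add_one_self) auto
      also have "\<dots> = exp (ln (card U) + T * Suc n / r)"
        using cU by (simp add: exp_add exp_of_nat_mult[symmetric] distrib_left)
      finally have "ln ((2::real) ^ Y) \<le> ln (exp (ln (card U) + T * Suc n / r))"
        by (intro ln_mono) auto
      then show ?thesis by (simp only: ln_exp X_def ln_realpow le_divide_eq) simp
    qed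
    ultimately show ?thesis by linarith
  qed
  obtain s where s: "\<And>\<tau>. s \<tau> \<in> {-1, 1::real}"
    and sbound: "\<And>u. u \<in> U \<Longrightarrow> \<bar>\<Sum>\<tau><T. s \<tau> * e \<tau> u\<bar> \<le> E * sqrt X * (ln (2 * card U) + 1 / 2)"
  proof -
    from ex_signs_small_sum[where e = e and T = T, OF U(1,2) \<open>E > 0\<close> \<open>X > 0\<close> ebound supp]
    obtain s where "(\<forall>\<tau>. s \<tau> \<in> {-1, 1}) \<and>
      (\<forall>u\<in>U. \<bar>\<Sum>\<tau><T. s \<tau> * e \<tau> u\<bar> \<le> E * sqrt X * (ln (2 * card U) + 1 / 2))" by (rule exE)
    then show ?thesis by (intro that[of s]) simp_all
  qed
  define D where "D = (\<lambda>i. \<Sum>\<tau><T. s \<tau> * C \<tau> i)"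
  have D1: "D i = s \<tau> * C \<tau> i" if "\<tau> < T" "i \<in> G \<tau>" for i \<tau>
  proof -
    have "C \<tau>' i = 0" if "\<tau>' < T" "\<tau>' \<noteq> \<tau>" for \<tau>'
    proof -
      have "G \<tau> \<inter> G \<tau>' = {}" using disj that \<open>\<tau> < T\<close> unfolding disjoint_family_on_def by simp
      then show ?thesis using C[OF that(1)] \<open>i \<in> G \<tau>\<close> by blast
    qed
    then have "D i = (\<Sum>\<tau>'\<in>{\<tau>}. s \<tau>' * C \<tau>' i)"
      unfolding D_def using that by (intro sum.mono_neutral_right) auto
    then show ?thesis by simp
  qed
  have s1: "\<bar>s \<tau>\<bar> = 1" for \<tau> using s[of \<tau>] by auto
  have D_le: "\<bar>D i\<bar> \<le> 1" for i
  proof (cases "\<exists>\<tau><T. i \<in> G \<tau>")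
    case True
    then obtain \<tau> where t: "\<tau> < T" "i \<in> G \<tau>" by blast
    show ?thesis using D1[OF t] s1[of \<tau>] C[OF t(1)] by (simp add: abs_mult)
  next
    case False
    then have "D i = 0" unfolding D_def using C by (intro sum.neutral) auto
    then show ?thesis by simp
  qed
  have Dsum: "(\<Sum>i<N. D i * f i) = (\<Sum>\<tau><T. s \<tau> * (\<Sum>i\<in>G \<tau>. C \<tau> i * f i))" for f
  proof -
    have "(\<Sum>i<N. D i * f i) = (\<Sum>i<N. \<Sum>\<tau><T. s \<tau> * (C \<tau> i * f i))"
      by (simp add: D_def sum_distrib_right mult.assoc)
    also have "\<dots> = (\<Sum>\<tau><T. \<Sum>i<N. s \<tau> * (C \<tau> i * f i))" by (rule sum.swap)
    also have "\<dots> = (\<Sum>\<tau><T. s \<tau> * (\<Sum>i\<in>G \<tau>. C \<tau> i * f i))"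
    proof (intro sum.cong refl)
      fix \<tau> assume "\<tau> \<in> {..<T}"
      then have t: "\<tau> < T" by simp
      have "(\<Sum>i<N. C \<tau> i * f i) = (\<Sum>i\<in>G \<tau>. C \<tau> i * f i)"
        using G[OF t] IN C[OF t] by (intro sum.mono_neutral_right) auto
      then show "(\<Sum>i<N. s \<tau> * (C \<tau> i * f i)) = s \<tau> * (\<Sum>i\<in>G \<tau>. C \<tau> i * f i)"
        by (simp only: sum_distrib_left[symmetric])
    qed
    finally show ?thesis .
  qed
  \<comment> \<open>The indices of the segments that vanish for the signs \<open>s\<close> and for their negatives.\<close>
  define Z where "Z = (\<lambda>\<sigma>. {i\<in>{..<N}. 1 + \<sigma> * D i = 0})"
  have finZ: "finite (Z \<sigma>)" for \<sigma> by (simp add: Z_def)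
  have "T \<le> card (Z 1) + card (Z (-1))"
  proof -
    obtain j where j: "\<And>\<tau>. \<tau> < T \<Longrightarrow> j \<tau> \<in> G \<tau> \<and> \<bar>C \<tau> (j \<tau>)\<bar> = 1" using C by metis
    have "inj_on j {..<T}"
    proof (rule inj_onI, rule ccontr)
      fix x y assume xy: "x \<in> {..<T}" "y \<in> {..<T}" "j x = j y" "x \<noteq> y"
      then have "G x \<inter> G y = {}" using disj unfolding disjoint_family_on_def by simp
      then show False using j[of x] j[of y] xy by auto
    qed
    then have "T = card (j ` {..<T})" by (simp add: card_image)
    also have "\<dots> \<le> card (Z 1 \<union> Z (-1))"
    proof (rule card_mono)
      show "finite (Z 1 \<union> Z (-1))" using finZ by simp
      show "j ` {..<T} \<subseteq> Z 1 \<union> Z (-1)"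
      proof
        fix i assume "i \<in> j ` {..<T}"
        then obtain \<tau> where t: "\<tau> < T" "i = j \<tau>" by auto
        have "i \<in> G \<tau>" "\<bar>D i\<bar> = 1" using j[OF t(1)] t D1[OF t(1), of i] s1[of \<tau>] by (auto simp: abs_mult)
        moreover have "i < N" using G[OF t(1)] IN \<open>i \<in> G \<tau>\<close> by auto
        ultimately show "i \<in> Z 1 \<union> Z (-1)" by (auto simp: Z_def abs_if split: if_splits)
      qed
    qed
    also have "\<dots> \<le> card (Z 1) + card (Z (-1))" by (rule card_Un_le)
    finally show ?thesis .
  qed
  then obtain \<sigma> where \<sigma>: "\<sigma> \<in> {-1, 1::real}" "T \<le> 2 * card (Z \<sigma>)"
    by (cases "card (Z 1) \<le> card (Z (-1))") force+
  define \<gamma> where "\<gamma> = (\<lambda>i. 1 + \<sigma> * D i)"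
  have \<gamma>: "0 \<le> \<gamma> i" for i using D_le[of i] \<sigma>(1) by (auto simp: \<gamma>_def abs_le_iff)
  define ys where "ys = filter (\<lambda>y. y \<noteq> 0) (map (\<lambda>i. \<gamma> i *\<^sub>R xs ! i) [0..<N])"
  have "length ys = card {i. i < N \<and> \<gamma> i *\<^sub>R xs ! i \<noteq> 0}"
    unfolding ys_def by (subst length_filter_conv_card) (auto intro!: arg_cong[where f=card])
  also have "{i. i < N \<and> \<gamma> i *\<^sub>R xs ! i \<noteq> 0} \<subseteq> {..<N} - Z \<sigma>"
    by (auto simp: Z_def \<gamma>_def)
  then have "card {i. i < N \<and> \<gamma> i *\<^sub>R xs ! i \<noteq> 0} \<le> card ({..<N} - Z \<sigma>)"
    by (intro card_mono) auto
  also have "\<dots> = N - card (Z \<sigma>)"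
    using finZ by (subst card_Diff_subset) (auto simp: Z_def)
  finally have "length ys \<le> N - card (Z \<sigma>)" .
  moreover have "card (Z \<sigma>) \<le> N"
    using card_mono[of "{..<N}" "Z \<sigma>"] by (auto simp: Z_def)
  ultimately have "length ys + card (Z \<sigma>) \<le> N" by linarith
  then have l: "2 * length ys + T \<le> 2 * length xs" using \<sigma>(2) unfolding N_def by linarith
  have ytot: "total_size ys = (\<Sum>i<N. \<gamma> i * infnorm (xs ! i))"
    unfolding total_size_def ys_def using \<gamma>
    by (subst sum_list_filter_map_upt) (auto simp: infnorm_0 infnorm_mul)
  have tot: "total_size ys = total_size xs"
  proof -
    have "(\<Sum>i<N. \<gamma> i * infnorm (xs ! i)) = total_size xs + \<sigma> * (\<Sum>i<N. D i * infnorm (xs ! i))"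
      unfolding total_size_def sum_list_eq_sum_nth N_def \<gamma>_def
      by (simp add: algebra_simps sum.distrib sum_distrib_left)
    also have "(\<Sum>i<N. D i * infnorm (xs ! i)) = 0"
      unfolding Dsum
    proof (intro sum.neutral ballI)
      fix \<tau> assume "\<tau> \<in> {..<T}"
      then have t: "\<tau> < T" by simp
      have "(\<Sum>i\<in>G \<tau>. C \<tau> i * infnorm (xs ! i)) = (\<Sum>i\<in>G \<tau>. (C \<tau> i *\<^sub>R a i) \<bullet> b)"
        using Iab G[OF t] by (intro sum.cong) auto
      also have "\<dots> = (\<Sum>i\<in>G \<tau>. C \<tau> i *\<^sub>R a i) \<bullet> b" by (simp only: inner_sum_left)
      also have "\<dots> = 0" using C[OF t] by simp
      finally show "s \<tau> * (\<Sum>i\<in>G \<tau>. C \<tau> i * infnorm (xs ! i)) = 0" by simp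
    qed
    finally show ?thesis using ytot by simp
  qed
  have H: "\<bar>segment_sum xs u - segment_sum ys u\<bar> = \<bar>\<Sum>\<tau><T. s \<tau> * e \<tau> u\<bar>" for u
  proof -
    have "segment_sum ys u = (\<Sum>i<N. \<bar>u \<bullet> (\<gamma> i *\<^sub>R xs ! i)\<bar>)"
      unfolding segment_sum_def ys_def by (subst sum_list_filter_map_upt) auto
    also have "\<dots> = (\<Sum>i<N. \<bar>u \<bullet> xs ! i\<bar> + \<sigma> * (D i * \<bar>u \<bullet> a i\<bar>))"
    proof (intro sum.cong refl)
      fix i assume i: "i \<in> {..<N}"
      have "\<bar>u \<bullet> (\<gamma> i *\<^sub>R xs ! i)\<bar> = \<gamma> i * \<bar>u \<bullet> xs ! i\<bar>" using \<gamma>[of i] by (simp add: abs_mult)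
      then show "\<bar>u \<bullet> (\<gamma> i *\<^sub>R xs ! i)\<bar> = \<bar>u \<bullet> xs ! i\<bar> + \<sigma> * (D i * \<bar>u \<bullet> a i\<bar>)"
        using abs_a[of i u] i by (simp add: \<gamma>_def algebra_simps)
    qed
    also have "\<dots> = segment_sum xs u + \<sigma> * (\<Sum>i<N. D i * \<bar>u \<bullet> a i\<bar>)"
      unfolding segment_sum_def sum_list_eq_sum_nth N_def by (simp add: sum.distrib sum_distrib_left)
    also have "(\<Sum>i<N. D i * \<bar>u \<bullet> a i\<bar>) = (\<Sum>\<tau><T. s \<tau> * e \<tau> u)" unfolding Dsum e_def ..
    finally show ?thesis using \<sigma>(1) by auto
  qed
  show ?thesis using l tot H sbound unfolding E_def X_def by auto
qed

text \<open>Subdividing a segment into equal pieces does not change the zonotope.\<close>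

lemma ex_short_pieces:
  fixes xs :: "'a::euclidean_space list"
  assumes c: "0 < c"
  shows "\<exists>ys. 0 \<notin> set ys \<and> (\<forall>y\<in>set ys. infnorm y \<le> c) \<and> total_size ys = total_size xs \<and>
    segment_sum ys = segment_sum xs \<and> real (length ys) \<le> length xs + total_size xs / c"
proof (induction xs)
  case Nil
  show ?case by (intro exI[of _ "[]"]) (simp add: total_size_def)
next
  case (Cons x xs)
  then obtain ys where ys: "0 \<notin> set ys" "\<forall>y\<in>set ys. infnorm y \<le> c" "total_size ys = total_size xs"
    "segment_sum ys = segment_sum xs" "real (length ys) \<le> length xs + total_size xs / c" by blast
  define p where "p = nat \<lceil>infnorm x / c\<rceil>"
  have nn: "0 \<le> infnorm x / c" using c by (simp add: infnorm_pos_le)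
  have p1: "infnorm x / c \<le> p" "p \<le> infnorm x / c + 1" using nn unfolding p_def by linarith+
  have p0: "p = 0 \<longleftrightarrow> x = 0"
  proof
    assume "p = 0"
    then have "infnorm x / c \<le> 0" using p1(1) by simp
    then show "x = 0" using c infnorm_pos_lt[of x] by (auto simp: divide_le_0_iff)
  qed (simp add: p_def infnorm_0)
  define zs where "zs = replicate p ((1 / p) *\<^sub>R x) @ ys"
  have "0 \<notin> set zs" using ys(1) p0 by (auto simp: zs_def)
  moreover have "infnorm ((1 / p) *\<^sub>R x) \<le> c" if "p > 0"
    using p1(1) c that by (simp add: infnorm_mul field_simps)
  then have "\<forall>y\<in>set zs. infnorm y \<le> c" using ys(2) by (auto simp: zs_def)
  moreover have "total_size zs = total_size (x # xs)"
    using ys(3) p0 by (auto simp: zs_def total_size_def infnorm_mul sum_list_replicate infnorm_0)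
  moreover have "segment_sum zs = segment_sum (x # xs)"
  proof
    fix u
    show "segment_sum zs u = segment_sum (x # xs) u"
      using fun_cong[OF ys(4), of u] p0 by (auto simp: zs_def segment_sum_def sum_list_replicate abs_mult)
  qed
  moreover have "real (length zs) \<le> length (x # xs) + total_size (x # xs) / c"
    using ys(5) p1(2) by (simp add: zs_def total_size_def add_divide_distrib)
  ultimately show ?case by blast
qed

section \<open>Iterating the reduction\<close>

text \<open>The finite sets of directions on which errors are controlled. The bound is on the coordinates and not
  on the norm, because rounding the coordinates of a unit vector may increase its norm.\<close>

definition boxed :: "'a::euclidean_space set \<Rightarrow> bool" where
  "boxed U \<longleftrightarrow> finite U \<and> U \<noteq> {} \<and> (\<forall>u\<in>U. \<forall>c\<in>Basis. \<bar>u \<bullet> c\<bar> \<le> 1)"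

text \<open>A state of the reduction: the budget \<open>M\<close> bounds the number of segments, and no segment is much
  larger than the average size that this budget allows.\<close>

definition admissible :: "real \<Rightarrow> real \<Rightarrow> real \<Rightarrow> 'a::euclidean_space list \<Rightarrow> bool" where
  "admissible B W M xs \<longleftrightarrow> real (length xs) \<le> M \<and> 0 \<notin> set xs \<and>
     (\<forall>x\<in>set xs. infnorm x \<le> B / M) \<and> total_size xs \<le> W"

text \<open>The fraction of the segments that one reduction step is sure to remove: a group consists of \<open>n + 1\<close>
  vectors, one chart holds at least \<open>1 / n\<close> of them all, and the remaining constant \<open>16\<close> is a product of
  four factors \<open>2\<close>, for lists with only \<open>M / 2\<close> vectors, for the half of a chart that stays
  ungrouped, for rounding the number of groups, and for the groups that lose no vector.\<close>

definition loss :: "nat \<Rightarrow> real" where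
  "loss n = 1 / (16 * real n * (real n + 1))"

lemma loss_bounds: "0 < n \<Longrightarrow> 0 < loss n" "loss n \<le> 1"
proof -
  show "0 < loss n" if "0 < n" using that by (simp add: loss_def)
  show "loss n \<le> 1"
  proof (cases "n = 0")
    case False
    then have "1 * 1 \<le> 16 * real n * (real n + 1)" by (intro mult_mono) auto
    then show ?thesis using False by (simp add: loss_def divide_le_eq)
  qed (simp add: loss_def)
qed

text \<open>The loss of \<open>\<epsilon>\<close> in the exponent \<open>\<kappa>\<close> absorbs the logarithm: the number of cells of the arrangement with
  \<open>r = M powr \<kappa>\<close> is of order \<open>M powr (1 - (n - 1) * \<epsilon>)\<close> times a power of \<open>ln M\<close>.\<close>

lemma eventually_parameters_fit:
  fixes n :: nat
  assumes n: "2 \<le> n" and \<epsilon>: "0 < \<epsilon>" "\<epsilon> < 1 / (real n - 1)"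
  defines "\<kappa> \<equiv> 1 / (real n - 1) - \<epsilon>"
  shows "eventually (\<lambda>M. real n * (real n * (M powr \<kappa> * (2 * ln M + 3 + 3 * real n)) ^ (n - 1) + 1) \<le> M / 4) at_top"
proof -
  define d where "d = real n - 1"
  have d: "d > 0" "real (n - 1) = d" using n by (simp_all add: d_def of_nat_diff)
  have \<kappa>: "\<kappa> = 1 / d - \<epsilon>" using n by (simp add: \<kappa>_def d_def)
  have e1: "eventually (\<lambda>M. 2 * ln M + 3 + 3 * real n \<le> M powr (\<epsilon> / 2)) at_top"
    using \<epsilon> by real_asymp
  have e2: "eventually (\<lambda>M. real n * (real n * M powr (1 - d * \<epsilon> / 2) + 1) \<le> M / 4) at_top"
  proof -
    define a where "a = d * \<epsilon> / 2"
    have a: "a > 0" using d \<epsilon> by (simp add: a_def)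
    have p: "((\<lambda>M::real. M powr (- a)) \<longlongrightarrow> 0) at_top" using a by real_asymp
    have q: "((\<lambda>M::real. 1 / M) \<longlongrightarrow> 0) at_top" by real_asymp
    have "((\<lambda>M. real n * (real n * M powr (- a) + 1 / M)) \<longlongrightarrow> 0) at_top"
      using tendsto_mult_left[OF tendsto_add[OF tendsto_mult_left[OF p, of "real n"] q], of "real n"] by simp
    then have "eventually (\<lambda>M. real n * (real n * M powr (- a) + 1 / M) < 1 / 4) at_top"
      by (rule order_tendstoD) simp
    then show ?thesis using eventually_gt_at_top[of 0]
    proof eventually_elim
      case (elim M)
      have "real n * (real n * M powr (1 - a) + 1) = M * (real n * (real n * M powr (- a) + 1 / M))"
        using elim(2) by (simp add: powr_diff powr_minus field_simps)
      also have "\<dots> \<le> M * (1 / 4)" using elim by (intro mult_left_mono) auto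
      finally show ?case by (simp add: a_def)
    qed
  qed
  show ?thesis using e1 e2 eventually_gt_at_top[of 1]
  proof eventually_elim
    case (elim M)
    have "(M powr \<kappa> * (2 * ln M + 3 + 3 * real n)) ^ (n - 1) \<le> (M powr \<kappa> * M powr (\<epsilon> / 2)) ^ (n - 1)"
      using elim by (intro power_mono mult_left_mono) auto
    also have "\<dots> = (M powr (\<kappa> + \<epsilon> / 2)) powr d"
      using elim by (simp add: powr_add[symmetric] d(2)[symmetric] powr_realpow)
    also have "\<dots> = M powr (1 - d * \<epsilon> / 2)"
      using d by (simp add: powr_powr \<kappa> algebra_simps)
    finally have "real n * (real n * (M powr \<kappa> * (2 * ln M + 3 + 3 * real n)) ^ (n - 1) + 1)
      \<le> real n * (real n * M powr (1 - d * \<epsilon> / 2) + 1)" by (intro mult_left_mono add_mono) auto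
    then show ?case using elim(2) by linarith
  qed
qed

text \<open>The logarithmic factor in \<open>ex_signs_small_sum\<close>.\<close>

definition log_card :: "'a set \<Rightarrow> real" where
  "log_card U = ln (2 * real (card U)) + 1 / 2"

lemma log_card_ge_1:
  assumes "finite U" "U \<noteq> {}" shows "1 \<le> log_card U"
proof -
  have "1 \<le> real (card U)" using assms by (simp add: Suc_le_eq card_gt_0_iff)
  then have "ln 2 \<le> ln (2 * real (card U))" by (intro ln_mono) auto
  moreover have "(1::real) / 2 \<le> ln 2" using ln2_ge_two_thirds by simp
  ultimately show ?thesis unfolding log_card_def by linarith
qed

text \<open>The arithmetic of one round. The segments have size \<open>B / M\<close>, a group has width \<open>1 / r\<close>, and about
  \<open>M / r\<close> of the groups are crossed, so the error is of order
  \<open>1 / M * 1 / r * sqrt (M / r)\<close> with \<open>r\<close> of order \<open>M powr \<kappa>\<close>.\<close>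

lemma error_exponent_bound:
  fixes M \<kappa> r \<Lambda> n B t lu :: real
  assumes M: "1 \<le> M" and r: "M powr \<kappa> / 2 \<le> r" "0 < r" "r \<le> M" and n: "0 \<le> n" and B: "0 \<le> B"
    and \<Lambda>: "1 \<le> \<Lambda>" "lu \<le> \<Lambda>" and t: "t \<le> M" "0 \<le> lu" "0 \<le> t"
  shows "(n + 1) * (B / M * (n / r)) * sqrt ((lu + t / r) / ln 2) * \<Lambda>
    \<le> 8 * (n + 1) * n * B * \<Lambda>\<^sup>2 * M powr (- (1 / 2 + 3 / 2 * \<kappa>))"
proof -
  define \<rho> where "\<rho> = M powr \<kappa>"
  have \<rho>: "\<rho> > 0" "\<rho> / 2 \<le> r" using M r by (auto simp: \<rho>_def)
  have ir: "1 / r \<le> 2 / \<rho>" using \<rho> r(2) by (simp add: field_simps)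
  have Mr: "1 \<le> M / r" using r by simp
  have "lu + t / r \<le> \<Lambda> * (M / r) + M / r"
  proof (intro add_mono)
    have "lu * 1 \<le> \<Lambda> * (M / r)" using \<Lambda> Mr t by (intro mult_mono) auto
    then show "lu \<le> \<Lambda> * (M / r)" by simp
    show "t / r \<le> M / r" using t r by (intro divide_right_mono) auto
  qed
  also have "\<dots> \<le> \<Lambda> * (M / r) + \<Lambda> * (M / r)"
  proof -
    have "1 * (M / r) \<le> \<Lambda> * (M / r)" using \<Lambda>(1) Mr by (intro mult_right_mono) auto
    then show ?thesis by linarith
  qed
  also have "\<dots> \<le> 2 * \<Lambda> * (2 * (M / \<rho>))"
  proof -
    have "M * (1 / r) \<le> M * (2 / \<rho>)" using ir M by (intro mult_left_mono) auto
    then have "M / r \<le> 2 * (M / \<rho>)" by (simp add: mult.commute)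
    then have le: "\<Lambda> * (M / r) \<le> \<Lambda> * (2 * (M / \<rho>))" using \<Lambda> by (intro mult_left_mono) auto
    have "2 * \<Lambda> * (2 * (M / \<rho>)) = \<Lambda> * (2 * (M / \<rho>)) + \<Lambda> * (2 * (M / \<rho>))" by simp
    then show ?thesis using add_mono[OF le le] by (simp only:)
  qed
  finally have a: "lu + t / r \<le> 4 * \<Lambda> * (M / \<rho>)" by simp
  have ln2: "1 / 2 \<le> ln (2::real)" using ln2_ge_two_thirds by simp
  have "(lu + t / r) / ln 2 \<le> (lu + t / r) / (1 / 2)"
    using ln2 t r by (intro divide_left_mono) auto
  also have "\<dots> = 2 * (lu + t / r)" by simp
  also have "\<dots> \<le> 2 * (4 * \<Lambda> * (M / \<rho>))" using a by (rule mult_left_mono) simp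
  also have "\<dots> = 8 * \<Lambda> * (M / \<rho>)" by simp
  also have "\<dots> \<le> 16 * \<Lambda>\<^sup>2 * (M / \<rho>)"
  proof -
    have "\<Lambda> * 1 \<le> \<Lambda> * \<Lambda>" using \<Lambda>(1) by (intro mult_left_mono) auto
    then have "8 * \<Lambda> \<le> 16 * \<Lambda>\<^sup>2" unfolding power2_eq_square using \<Lambda>(1) by linarith
    then show ?thesis using M \<rho> by (intro mult_right_mono) auto
  qed
  also have "\<dots> = (4 * \<Lambda>)\<^sup>2 * (M / \<rho>)" by (simp add: power_mult_distrib)
  finally have "sqrt ((lu + t / r) / ln 2) \<le> sqrt ((4 * \<Lambda>)\<^sup>2 * (M / \<rho>))" by (rule real_sqrt_le_mono)
  also have "\<dots> = 4 * \<Lambda> * sqrt (M / \<rho>)"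
  proof -
    have "sqrt ((4 * \<Lambda>)\<^sup>2) = 4 * \<Lambda>" using \<Lambda>(1) unfolding real_sqrt_abs by simp
    then show ?thesis by (simp only: real_sqrt_mult)
  qed
  finally have sq: "sqrt ((lu + t / r) / ln 2) \<le> 4 * \<Lambda> * sqrt (M / \<rho>)" .
  have "(n + 1) * (B / M * (n / r)) = (n + 1) * n * B * (1 / M) * (1 / r)" by simp
  also have "\<dots> \<le> (n + 1) * n * B * (1 / M) * (2 / \<rho>)"
    using n B M ir by (intro mult_left_mono) auto
  finally have pre: "(n + 1) * (B / M * (n / r)) \<le> (n + 1) * n * B * (1 / M) * (2 / \<rho>)" .
  have "(n + 1) * (B / M * (n / r)) * sqrt ((lu + t / r) / ln 2)
      \<le> ((n + 1) * n * B * (1 / M) * (2 / \<rho>)) * (4 * \<Lambda> * sqrt (M / \<rho>))"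
    by (rule mult_mono[OF pre sq]) (use n B M \<rho> t r ln2 in auto)
  then have "(n + 1) * (B / M * (n / r)) * sqrt ((lu + t / r) / ln 2) * \<Lambda>
      \<le> ((n + 1) * n * B * (1 / M) * (2 / \<rho>)) * (4 * \<Lambda> * sqrt (M / \<rho>)) * \<Lambda>"
    using \<Lambda> by (intro mult_right_mono) auto
  also have "\<dots> = 8 * (n + 1) * n * B * \<Lambda>\<^sup>2 * ((1 / M) * (1 / \<rho>) * sqrt (M / \<rho>))"
    by (simp add: power2_eq_square)
  also have "(1 / M) * (1 / \<rho>) * sqrt (M / \<rho>) = M powr (- (1 / 2 + 3 / 2 * \<kappa>))"
  proof -
    have "sqrt (M / \<rho>) = (M powr (1 - \<kappa>)) powr (1 / 2)"
      unfolding \<rho>_def powr_diff using M by (subst powr_half_sqrt) auto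
    also have "\<dots> = M powr ((1 - \<kappa>) / 2)" by (simp add: powr_powr)
    finally have s: "sqrt (M / \<rho>) = M powr ((1 - \<kappa>) / 2)" .
    have "(1 / M) * (1 / \<rho>) * sqrt (M / \<rho>) = M powr (- 1) * M powr (- \<kappa>) * M powr ((1 - \<kappa>) / 2)"
    proof -
      have a: "1 / M = M powr (- 1)" using M by (simp add: powr_minus_divide)
      have b: "1 / \<rho> = M powr (- \<kappa>)" by (simp add: \<rho>_def powr_minus_divide)
      show ?thesis unfolding s a b ..
    qed
    also have "\<dots> = M powr (- 1 + - \<kappa> + (1 - \<kappa>) / 2)" by (simp only: powr_add)
    also have "- 1 + - \<kappa> + (1 - \<kappa>) / 2 = - (1 / 2 + 3 / 2 * \<kappa>)" by (simp add: field_simps)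
    finally show ?thesis .
  qed
  finally show ?thesis .
qed

text \<open>A reduction step followed by a subdivision of the long segments. From a list of between \<open>q * M\<close> and \<open>M\<close> segments the step
  removes at least \<open>loss n * M\<close> of them, and the constant \<open>B = 2 / loss n * W\<close> is chosen so that the
  subdivision brings back at most half of that number. So the budget \<open>M\<close> shrinks by the factor \<open>q\<close>,
  while the bound \<open>B / M\<close> on the sizes keeps its form.\<close>

lemma ex_one_round:
  fixes W \<epsilon> :: real
  defines "n \<equiv> DIM('a::euclidean_space)"
  assumes n: "2 \<le> n" and \<epsilon>: "0 < \<epsilon>" "\<epsilon> < 1 / (real n - 1)" and W: "0 < W"
  defines "\<gamma> \<equiv> 1 / 2 + 3 / 2 * (1 / (real n - 1) - \<epsilon>)" and "q \<equiv> 1 - loss n / 2" and "B \<equiv> 2 / loss n * W"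
  shows "\<exists>C>0. \<exists>M0\<ge>1. \<forall>M\<ge>M0. \<forall>(U::'a set) xs. boxed U \<longrightarrow> admissible B W M xs \<longrightarrow>
    (\<exists>ys. admissible B W (q * M) ys \<and>
      (\<forall>u\<in>U. \<bar>segment_sum xs u - segment_sum ys u\<bar> \<le> C * (log_card U)\<^sup>2 * M powr (- \<gamma>)))"
proof -
  define \<kappa> where "\<kappa> = 1 / (real n - 1) - \<epsilon>"
  have \<kappa>: "0 < \<kappa>" "\<kappa> \<le> 1"
  proof -
    show "0 < \<kappa>" using \<epsilon> by (simp add: \<kappa>_def)
    have "1 / (real n - 1) \<le> 1" using n by (simp add: divide_le_eq)
    then show "\<kappa> \<le> 1" using \<epsilon> by (simp add: \<kappa>_def)
  qed
  have th: "0 < loss n" "loss n \<le> 1" using loss_bounds n by auto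
  have q: "1 / 2 \<le> q" "q < 1" using th by (auto simp: q_def)
  have B: "0 < B" using th W by (simp add: B_def)
  obtain M1 where M1: "\<And>M. M \<ge> M1 \<Longrightarrow>
      real n * (real n * (M powr \<kappa> * (2 * ln M + 3 + 3 * real n)) ^ (n - 1) + 1) \<le> M / 4"
    using eventually_parameters_fit[OF n \<epsilon>] unfolding \<kappa>_def eventually_at_top_linorder by blast
  define M0 where "M0 = max M1 (8 * real n * (real n + 1))"
  define C where "C = 8 * (real n + 1) * n * B"
  have "C > 0" using B n by (simp add: C_def)
  have "\<exists>ys. admissible B W (q * M) ys \<and>
      (\<forall>u\<in>U. \<bar>segment_sum xs u - segment_sum ys u\<bar> \<le> C * (log_card U)\<^sup>2 * M powr (- \<gamma>))"
    if M: "M \<ge> M0" and U: "boxed U" and xs: "admissible B W M xs" for M and U :: "'a set" and xs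
  proof (cases "real (length xs) \<le> q * M")
    case True
    have "1 * 1 \<le> real n * (real n + 1)" using n by (intro mult_mono) auto
    moreover have "8 * real n * (real n + 1) \<le> M" using M by (simp only: M0_def max.bounded_iff)
    ultimately have M': "0 < M" by linarith
    have "B / M \<le> B / (q * M)" using q M' B by (intro divide_left_mono) auto
    then have "admissible B W (q * M) xs" using xs True by (force simp: admissible_def)
    then show ?thesis using \<open>C > 0\<close> by (intro exI[of _ xs]) simp
  next
    case False
    have Mbig: "8 * real n * (real n + 1) \<le> M" using M by (simp only: M0_def max.bounded_iff)
    have "1 * 1 \<le> real n * (real n + 1)" using n by (intro mult_mono) auto
    then have Mgt: "1 < M" using Mbig by linarith
    define r where "r = nat \<lfloor>M powr \<kappa>\<rfloor>"
    have rho1: "1 \<le> M powr \<kappa>" using Mgt \<kappa> by (simp add: ge_one_powr_ge_zero)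
    have rle: "real r \<le> M powr \<kappa>" and rgt: "M powr \<kappa> < real r + 1" using rho1 unfolding r_def by linarith+
    have r0: "0 < r" using rgt rho1 by linarith
    then have "1 \<le> real r" by simp
    then have rge: "M powr \<kappa> / 2 \<le> real r" using rgt by linarith
    have "M powr \<kappa> \<le> M powr 1" using Mgt \<kappa> by (intro powr_mono) auto
    then have rM: "real r \<le> M" using rle Mgt by simp
    \<comment> \<open>This sample size makes \<open>M\<^sup>2 * (1 - 1 / r) ^ m\<close> smaller than one.\<close>
    define m where "m = nat \<lceil>2 * r * ln M\<rceil> + 1"
    have lnM: "0 \<le> ln M" using Mgt by simp
    have m1: "2 * r * ln M < real m" and m2: "real m \<le> 2 * r * ln M + 2"
      using mult_nonneg_nonneg[of "2 * real r" "ln M"] lnM unfolding m_def by linarith+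
    define N0 where "N0 = n * (m + n * (2 * r + 1) + 1) ^ (n - 1) + 1"
    \<comment> \<open>Some chart holds at least \<open>M / (2 * n)\<close> vectors; the groups use at most half of them, and at least \<open>N0\<close> remain.\<close>
    define T where "T = nat \<lfloor>M / (4 * real n * (real n + 1))\<rfloor>"
    have npos: "0 < 4 * real n * (real n + 1)" using n by simp
    have M2: "2 \<le> M / (4 * real n * (real n + 1))" using Mbig npos by (simp add: le_divide_eq)
    then have T1: "real T \<le> M / (4 * real n * (real n + 1))" and T2: "M / (4 * real n * (real n + 1)) < real T + 1"
      unfolding T_def by linarith+
    have "0 < T" using T2 M2 by linarith
    have TM: "real T * (real n + 1) * n \<le> M / 4" using T1 npos n by (simp add: field_simps)
    have T3: "2 * loss n * M \<le> real T"
    proof -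
      have half: "x / 2 \<le> y" if "2 \<le> x" "x < y + 1" for x y :: real using that by linarith
      have "M / (4 * real n * (real n + 1)) / 2 \<le> real T" by (rule half[OF M2 T2])
      then show ?thesis by (simp add: loss_def)
    qed
    have many: "(real (length xs))\<^sup>2 * (1 - 1 / real r) ^ m < 1"
    proof -
      have "(1 - 1 / real r) ^ m \<le> exp (- (1 / real r)) ^ m"
        using \<open>1 \<le> real r\<close> exp_ge_add_one_self[of "- (1 / real r)"] by (intro power_mono) auto
      also have "\<dots> = exp (- (real m / r))" by (simp add: exp_of_nat_mult[symmetric])
      also have "\<dots> < exp (- (2 * ln M))" using m1 r0 by (simp add: less_divide_eq mult_ac)
      also have "\<dots> = 1 / M\<^sup>2" using Mgt by (simp add: exp_minus exp_double divide_inverse power_inverse)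
      finally have "(1 - 1 / real r) ^ m < 1 / M\<^sup>2" .
      moreover have "(real (length xs))\<^sup>2 \<le> M\<^sup>2"
        using xs by (intro power_mono) (auto simp: admissible_def)
      moreover have "0 \<le> (1 - 1 / real r) ^ m" using \<open>1 \<le> real r\<close> by simp
      ultimately have "(real (length xs))\<^sup>2 * (1 - 1 / real r) ^ m \<le> M\<^sup>2 * (1 - 1 / real r) ^ m"
        by (intro mult_right_mono) auto
      also have "\<dots> < M\<^sup>2 * (1 / M\<^sup>2)" using \<open>_ < 1 / M\<^sup>2\<close> Mgt by (intro mult_strict_left_mono) auto
      finally show ?thesis using Mgt by simp
    qed
    have "real (n * N0) \<le> M / 4"
    proof -
      have "real m + real n * (2 * r + 1) + 1 \<le> (2 * r * ln M + 2) + real n * (2 * r + 1) + 1" using m2 by simp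
      also have "\<dots> \<le> r * (2 * ln M + 3 + 3 * real n)"
      proof -
        have "3 + real n \<le> real r * (3 + real n)" using \<open>1 \<le> real r\<close> by simp
        then show ?thesis by (simp add: algebra_simps)
      qed
      also have "\<dots> \<le> M powr \<kappa> * (2 * ln M + 3 + 3 * real n)" using rle lnM by (intro mult_right_mono) auto
      finally have "(real m + real n * (2 * r + 1) + 1) ^ (n - 1) \<le> (M powr \<kappa> * (2 * ln M + 3 + 3 * real n)) ^ (n - 1)"
        by (intro power_mono) auto
      then have "real (n * N0) \<le> real n * (real n * (M powr \<kappa> * (2 * ln M + 3 + 3 * real n)) ^ (n - 1) + 1)"
        unfolding N0_def by (simp add: algebra_simps mult_left_mono)
      also have "\<dots> \<le> M / 4" using M1 M by (simp add: M0_def)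
      finally show ?thesis .
    qed
    moreover have "q * M < real (length xs)" using False by simp
    moreover have "M / 2 \<le> q * M" using q(1) Mgt mult_right_mono[of "1/2" q M] by simp
    moreover have "real (n * (T * Suc n + N0)) = real T * (real n + 1) * n + real (n * N0)" by (simp add: algebra_simps)
    ultimately have "real (n * (T * Suc n + N0)) \<le> real (length xs)" using TM by linarith
    then have len: "n * (T * Suc n + N0) \<le> length xs" by (simp only: of_nat_le_iff)
    have BM: "0 < B / M" using B Mgt by simp
    have xs': "0 \<notin> set xs" "\<And>x. x \<in> set xs \<Longrightarrow> infnorm x \<le> B / M" "real (length xs) \<le> M" "total_size xs \<le> W"
      using xs by (auto simp: admissible_def)
    have U': "finite U" "U \<noteq> {}" "\<And>u c. u \<in> U \<Longrightarrow> c \<in> Basis \<Longrightarrow> \<bar>u \<bullet> c\<bar> \<le> 1"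
      using U by (auto simp: boxed_def)
    have pat: "n * (m + n * (2 * r + 1) + 1) ^ (n - 1) < N0" by (simp add: N0_def)
    from ex_fewer_segments[OF xs'(1,2) BM U' r0 \<open>0 < T\<close> many pat[unfolded n_def] len[unfolded n_def]]
    obtain ys where "total_size ys = total_size xs \<and>
      2 * length ys + T \<le> 2 * length xs \<and>
      (\<forall>u\<in>U. \<bar>segment_sum xs u - segment_sum ys u\<bar> \<le> Suc n * (B / M * (n / r)) *
         sqrt ((ln (card U) + T * Suc n / r) / ln 2) * (ln (2 * card U) + 1 / 2))"
      unfolding n_def by (rule exE)
    then have ys: "total_size ys = total_size xs" "2 * length ys + T \<le> 2 * length xs"
      "\<And>u. u \<in> U \<Longrightarrow> \<bar>segment_sum xs u - segment_sum ys u\<bar> \<le> Suc n * (B / M * (n / r)) *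
         sqrt ((ln (card U) + T * Suc n / r) / ln 2) * (ln (2 * card U) + 1 / 2)" by auto
    have qM: "0 < q * M" using q Mgt by simp
    have c: "0 < B / (q * M)" using B qM by simp
    from ex_short_pieces[OF c, of ys] obtain zs where zs: "0 \<notin> set zs" "\<forall>z\<in>set zs. infnorm z \<le> B / (q * M)"
      "total_size zs = total_size ys" "segment_sum zs = segment_sum ys"
      "real (length zs) \<le> length ys + total_size ys / (B / (q * M))" by blast
    have "real (length zs) \<le> q * M"
    proof -
      have "total_size ys / (B / (q * M)) \<le> W / (B / (q * M))"
        using ys(1) xs'(4) c by (intro divide_right_mono) auto
      also have "\<dots> = loss n / 2 * (q * M)" using W th by (simp add: B_def)
      also have "\<dots> \<le> loss n / 2 * (1 * M)" using q th Mgt by (intro mult_left_mono mult_right_mono) auto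
      finally have a: "total_size ys / (B / (q * M)) \<le> loss n / 2 * M" by simp
      have "real (2 * length ys + T) \<le> real (2 * length xs)" using ys(2) by (simp only: of_nat_le_iff)
      then have "real (length ys) \<le> M - loss n * M" using T3 xs'(3) by simp
      moreover have "q * M = M - loss n * M + loss n / 2 * M" by (simp add: q_def algebra_simps)
      ultimately show ?thesis using zs(5) a by linarith
    qed
    then have "admissible B W (q * M) zs" using zs ys(1) xs'(4) by (simp add: admissible_def)
    moreover have "\<bar>segment_sum xs u - segment_sum zs u\<bar> \<le> C * (log_card U)\<^sup>2 * M powr (- \<gamma>)" if u: "u \<in> U" for u
    proof -
      have cU: "1 \<le> real (card U)" using U' by (simp add: Suc_le_eq card_gt_0_iff)
      have "ln (real (card U)) \<le> log_card U"
        unfolding log_card_def using cU by (intro add_increasing2 ln_mono) auto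
      moreover have "real T * (real n + 1) \<le> M"
      proof -
        have "real T * (real n + 1) * 1 \<le> real T * (real n + 1) * n" using n by (intro mult_left_mono) auto
        then show ?thesis using TM Mgt by linarith
      qed
      ultimately have "(real n + 1) * (B / M * (n / r)) * sqrt ((ln (card U) + (real T * (real n + 1)) / r) / ln 2) * log_card U
         \<le> 8 * (real n + 1) * n * B * (log_card U)\<^sup>2 * M powr (- (1 / 2 + 3 / 2 * \<kappa>))"
        using Mgt rge r0 rM B log_card_ge_1[OF U'(1,2)] cU by (intro error_exponent_bound) auto
      moreover have "Suc n * (B / M * (n / r)) * sqrt ((ln (card U) + T * Suc n / r) / ln 2) * (ln (2 * card U) + 1 / 2)
          = (real n + 1) * (B / M * (n / r)) * sqrt ((ln (card U) + (real T * (real n + 1)) / r) / ln 2) * log_card U"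
        by (simp only: log_card_def of_nat_mult of_nat_Suc of_nat_numeral add.commute[of 1])
      ultimately have "\<bar>segment_sum xs u - segment_sum ys u\<bar>
          \<le> 8 * (real n + 1) * n * B * (log_card U)\<^sup>2 * M powr (- (1 / 2 + 3 / 2 * \<kappa>))"
        using ys(3)[OF u] by (simp only:)
      then show ?thesis by (simp only: C_def \<gamma>_def \<kappa>_def zs(4))
    qed
    ultimately show ?thesis by blast
  qed
  moreover have "M0 \<ge> 1"
  proof -
    have "1 * 1 \<le> real n * (real n + 1)" using n by (intro mult_mono) auto
    then show ?thesis unfolding M0_def by (simp add: algebra_simps max_def)
  qed
  ultimately show ?thesis using \<open>C > 0\<close> by blast
qed


text \<open>The errors of the rounds form a geometric series that is dominated by the last round.\<close>

lemma ex_few_segments_from_round: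
  fixes \<gamma> q C M0 B W :: real
  assumes q: "0 < q" "q < 1" and \<gamma>: "0 < \<gamma>" and C: "0 < C" and M0: "1 \<le> M0"
    and round: "\<And>M (U::'a::euclidean_space set) xs. M0 \<le> M \<Longrightarrow> boxed U \<Longrightarrow> admissible B W M xs \<Longrightarrow>
      \<exists>ys. admissible B W (q * M) ys \<and>
        (\<forall>u\<in>U. \<bar>segment_sum xs u - segment_sum ys u\<bar> \<le> C * (log_card U)\<^sup>2 * M powr (- \<gamma>))"
    and N: "M0 \<le> N" and U: "boxed (U::'a set)" and xs: "admissible B W (N / q ^ j) xs"
  shows "\<exists>ys. admissible B W N ys \<and> (\<forall>u\<in>U. \<bar>segment_sum xs u - segment_sum ys u\<bar>
    \<le> C * (log_card U)\<^sup>2 * N powr (- \<gamma>) * (1 / (1 - q powr \<gamma>)))"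
proof -
  define p where "p = q powr \<gamma>"
  have p: "0 < p" "p < 1" using q \<gamma> powr_less_mono2[of \<gamma> q 1] by (auto simp: p_def)
  have N0: "0 < N" using N M0 by linarith
  have "\<exists>ys. admissible B W N ys \<and> (\<forall>u\<in>U. \<bar>segment_sum xs u - segment_sum ys u\<bar>
    \<le> C * (log_card U)\<^sup>2 * N powr (- \<gamma>) * (\<Sum>i<j. p ^ Suc i))"
    using xs
  proof (induction j arbitrary: xs)
    case 0
    then show ?case by (intro exI[of _ xs]) simp
  next
    case (Suc j)
    have "M0 \<le> N / q ^ Suc j"
    proof -
      have "N * q ^ Suc j \<le> N * 1" using q N0 by (intro mult_left_mono power_le_one) auto
      then have "N \<le> N / q ^ Suc j" using q by (simp add: le_divide_eq del: power_Suc)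
      then show ?thesis using N by linarith
    qed
    from round[OF this U Suc.prems] obtain ys where ys: "admissible B W (q * (N / q ^ Suc j)) ys"
      "\<And>u. u \<in> U \<Longrightarrow> \<bar>segment_sum xs u - segment_sum ys u\<bar> \<le> C * (log_card U)\<^sup>2 * (N / q ^ Suc j) powr (- \<gamma>)"
      by blast
    have "q * (N / q ^ Suc j) = N / q ^ j" using q by simp
    with ys(1) have "admissible B W (N / q ^ j) ys" by (simp only:)
    from Suc.IH[OF this] obtain zs where zs: "admissible B W N zs"
      "\<And>u. u \<in> U \<Longrightarrow> \<bar>segment_sum ys u - segment_sum zs u\<bar>
         \<le> C * (log_card U)\<^sup>2 * N powr (- \<gamma>) * (\<Sum>i<j. p ^ Suc i)" by blast
    have "(N / q ^ Suc j) powr (- \<gamma>) = N powr (- \<gamma>) / (q ^ Suc j) powr (- \<gamma>)"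
      by (rule powr_divide)
    also have "(q ^ Suc j) powr (- \<gamma>) = (q powr (- \<gamma>)) ^ Suc j"
      using q by (simp add: powr_power powr_realpow[symmetric] powr_powr mult.commute del: power_Suc)
    also have "\<dots> = 1 / p ^ Suc j" by (simp only: p_def powr_minus_divide power_one_over)
    finally have pw: "(N / q ^ Suc j) powr (- \<gamma>) = N powr (- \<gamma>) * p ^ Suc j" by simp
    have "\<bar>segment_sum xs u - segment_sum zs u\<bar>
         \<le> C * (log_card U)\<^sup>2 * N powr (- \<gamma>) * (\<Sum>i<Suc j. p ^ Suc i)" if u: "u \<in> U" for u
    proof -
      have "C * (log_card U)\<^sup>2 * N powr (- \<gamma>) * (\<Sum>i<Suc j. p ^ Suc i) =
         C * (log_card U)\<^sup>2 * (N / q ^ Suc j) powr (- \<gamma>) + C * (log_card U)\<^sup>2 * N powr (- \<gamma>) * (\<Sum>i<j. p ^ Suc i)"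
        unfolding pw by (simp add: algebra_simps)
      then show ?thesis using ys(2)[OF u] zs(2)[OF u] by linarith
    qed
    then show ?case using zs(1) by blast
  qed
  moreover have "(\<Sum>i<j. p ^ Suc i) \<le> 1 / (1 - p)"
  proof -
    have "(\<Sum>i<j. p ^ Suc i) = p * (\<Sum>i<j. p ^ i)" by (simp add: sum_distrib_left)
    also have "\<dots> \<le> 1 * (\<Sum>i<j. p ^ i)" using p by (intro mult_right_mono sum_nonneg) auto
    also have "\<dots> = (1 - p ^ j) / (1 - p)" using p by (simp add: sum_gp_strict)
    also have "\<dots> \<le> 1 / (1 - p)" using p by (intro divide_right_mono) auto
    finally show ?thesis .
  qed
  then have "C * (log_card U)\<^sup>2 * N powr (- \<gamma>) * (\<Sum>i<j. p ^ Suc i) \<le> C * (log_card U)\<^sup>2 * N powr (- \<gamma>) * (1 / (1 - p))"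
    using C by (intro mult_left_mono) auto
  ultimately show ?thesis unfolding p_def by (meson order.trans)
qed

text \<open>The approximation theorem behind the entropy bound: on a finite set of directions, every
  zonotope of bounded size is approximated by one with at most \<open>N\<close> segments. For \<open>\<epsilon> = 0\<close> the exponent \<open>\<gamma>\<close> would be
  \<open>(n + 2) / (2 * (n - 1))\<close>. The number of segments at the start is arbitrary; it is only used to
  choose the number of rounds.\<close>

lemma ex_few_segments:
  fixes W \<epsilon> :: real
  defines "n \<equiv> DIM('a::euclidean_space)"
  assumes n: "2 \<le> n" and \<epsilon>: "0 < \<epsilon>" "\<epsilon> < 1 / (real n - 1)" and W: "0 < W"
  defines "\<gamma> \<equiv> 1 / 2 + 3 / 2 * (1 / (real n - 1) - \<epsilon>)"
  shows "\<exists>C>0. \<exists>M0\<ge>1. \<forall>N\<ge>M0. \<forall>(U::'a set) xs. boxed U \<longrightarrow> total_size xs \<le> W \<longrightarrow>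
    (\<exists>ys. real (length ys) \<le> N \<and> total_size ys \<le> W \<and>
      (\<forall>u\<in>U. \<bar>segment_sum xs u - segment_sum ys u\<bar> \<le> C * (log_card U)\<^sup>2 * N powr (- \<gamma>)))"
proof -
  define q where "q = 1 - loss n / 2"
  define B where "B = 2 / loss n * W"
  have th: "0 < loss n" "loss n \<le> 1" using loss_bounds n by auto
  have q: "0 < q" "q < 1" using th by (auto simp: q_def)
  have B: "0 < B" using th W by (simp add: B_def)
  have \<gamma>: "0 < \<gamma>" using \<epsilon> unfolding \<gamma>_def by (intro add_pos_nonneg mult_nonneg_nonneg) auto
  obtain C M0 where C: "0 < C" and M0: "1 \<le> M0" and round: "\<forall>M\<ge>M0. \<forall>(U::'a set) xs. boxed U \<longrightarrow> admissible B W M xs \<longrightarrow>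
    (\<exists>ys. admissible B W (q * M) ys \<and>
      (\<forall>u\<in>U. \<bar>segment_sum xs u - segment_sum ys u\<bar> \<le> C * (log_card U)\<^sup>2 * M powr (- \<gamma>)))"
    using ex_one_round[where 'a = 'a, OF n[unfolded n_def] \<epsilon>[unfolded n_def] W]
    unfolding n_def[symmetric] \<gamma>_def[symmetric] q_def[symmetric] B_def[symmetric] by (elim exE conjE) simp
  have "\<exists>ys. real (length ys) \<le> N \<and> total_size ys \<le> W \<and>
      (\<forall>u\<in>U. \<bar>segment_sum xs u - segment_sum ys u\<bar> \<le> C * (1 / (1 - q powr \<gamma>)) * (log_card U)\<^sup>2 * N powr (- \<gamma>))"
    if N: "M0 \<le> N" and U: "boxed U" and xs: "total_size xs \<le> W" for N and U :: "'a set" and xs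
  proof -
    have N0: "0 < N" using N M0 by linarith
    obtain j where j: "q ^ j < N / (2 * length xs + 1)"
      using real_arch_pow_inv[of "N / (2 * length xs + 1)" q] q N0 by auto
    define M where "M = N / q ^ j"
    have M: "2 * length xs \<le> M"
    proof -
      have "q ^ j * (2 * length xs + 1) < N" using j by (simp add: field_simps)
      then have "2 * length xs + 1 < M" using q by (simp add: M_def less_divide_eq mult.commute)
      then show ?thesis by simp
    qed
    have M1: "0 < M" using N0 q by (simp add: M_def)
    have BM: "0 < B / M" using B M1 by simp
    from ex_short_pieces[OF BM, of xs] obtain xs' where xs': "0 \<notin> set xs'" "\<forall>y\<in>set xs'. infnorm y \<le> B / M"
      "total_size xs' = total_size xs" "segment_sum xs' = segment_sum xs"
      "real (length xs') \<le> length xs + total_size xs / (B / M)" by blast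
    have "total_size xs / (B / M) \<le> W / (B / M)" using xs BM by (intro divide_right_mono) auto
    also have "\<dots> = loss n / 2 * M" using W th by (simp add: B_def)
    also have "\<dots> \<le> 1 / 2 * M" using th M1 by (intro mult_right_mono) auto
    finally have "real (length xs') \<le> M" using xs'(5) M by linarith
    then have "admissible B W (N / q ^ j) xs'" using xs' xs by (simp add: admissible_def M_def)
    from ex_few_segments_from_round[OF q \<gamma> C M0 _ N U this] round
    obtain ys where ys: "admissible B W N ys" "\<And>u. u \<in> U \<Longrightarrow> \<bar>segment_sum xs' u - segment_sum ys u\<bar>
      \<le> C * (log_card U)\<^sup>2 * N powr (- \<gamma>) * (1 / (1 - q powr \<gamma>))" by blast
    then show ?thesis unfolding xs'(4) by (intro exI[of _ ys]) (auto simp: admissible_def mult_ac)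
  qed
  moreover have "0 < C * (1 / (1 - q powr \<gamma>))"
    using q \<gamma> C powr_less_mono2[of \<gamma> q 1] by auto
  ultimately show ?thesis using M0 by blast
qed

section \<open>Support functions of zonoids\<close>

lemma support_fn_plus:
  fixes A B :: "'a::euclidean_space set"
  assumes "compact A" "A \<noteq> {}" "compact B" "B \<noteq> {}"
  shows "support_fn (A + B) x = support_fn A x + support_fn B x"
proof -
  obtain a where a: "a \<in> A" "support_fn A x = x \<bullet> a" "\<And>z. z \<in> A \<Longrightarrow> x \<bullet> z \<le> x \<bullet> a"
    using support_fn_attained[OF assms(1,2)] by metis
  obtain b where b: "b \<in> B" "support_fn B x = x \<bullet> b" "\<And>z. z \<in> B \<Longrightarrow> x \<bullet> z \<le> x \<bullet> b"
    using support_fn_attained[OF assms(3,4)] by metis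
  have "support_fn (A + B) x = x \<bullet> (a + b)"
    unfolding support_fn_def
  proof (rule cSup_eq_maximum)
    show "x \<bullet> (a + b) \<in> (\<bullet>) x ` (A + B)" using a(1) b(1) by (auto intro: set_plus_intro)
    show "y \<le> x \<bullet> (a + b)" if "y \<in> (\<bullet>) x ` (A + B)" for y
    proof -
      obtain v w where "v \<in> A" "w \<in> B" "y = x \<bullet> (v + w)" using \<open>y \<in> _\<close> by (auto elim!: set_plus_elim)
      then show ?thesis using add_mono[OF a(3)[of v] b(3)[of w]] by (simp add: inner_add_right)
    qed
  qed
  then show ?thesis using a(2) b(2) by (simp add: inner_add_right)
qed

lemma support_fn_closed_segment:
  "support_fn (closed_segment a b) x = max (x \<bullet> a) (x \<bullet> b)"
  unfolding support_fn_def
proof (rule cSup_eq_maximum)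
  show "max (x \<bullet> a) (x \<bullet> b) \<in> (\<bullet>) x ` closed_segment a b"
    by (cases "x \<bullet> a \<le> x \<bullet> b") (auto simp: max_def)
  show "y \<le> max (x \<bullet> a) (x \<bullet> b)" if "y \<in> (\<bullet>) x ` closed_segment a b" for y
  proof -
    from that obtain s where s: "0 \<le> s" "s \<le> 1" "y = x \<bullet> ((1 - s) *\<^sub>R a + s *\<^sub>R b)"
      by (auto simp: closed_segment_def)
    have "y = (1 - s) * (x \<bullet> a) + s * (x \<bullet> b)" using s(3) by (simp add: inner_add_right)
    also have "\<dots> \<le> (1 - s) * max (x \<bullet> a) (x \<bullet> b) + s * max (x \<bullet> a) (x \<bullet> b)"
      using s by (intro add_mono mult_left_mono) auto
    also have "\<dots> = max (x \<bullet> a) (x \<bullet> b)" by (simp add: algebra_simps)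
    finally show ?thesis .
  qed
qed

lemma support_fn_sum_segments:
  fixes a b :: "nat \<Rightarrow> 'a::euclidean_space"
  defines "Z \<equiv> \<lambda>m. \<Sum>i<m. closed_segment (a i) (b i)"
  shows "compact (Z m) \<and> Z m \<noteq> {} \<and> support_fn (Z m) x = (\<Sum>i<m. max (x \<bullet> a i) (x \<bullet> b i))"
proof (induction m)
  case 0
  have "Z 0 = {0}" by (simp add: Z_def set_zero)
  then show ?case by (simp add: support_fn_def)
next
  case (Suc m)
  have eq: "Z (Suc m) = Z m + closed_segment (a m) (b m)" by (simp add: Z_def)
  have c: "compact (closed_segment (a m) (b m))" "closed_segment (a m) (b m) \<noteq> {}" by auto
  have "compact (Z (Suc m))"
  proof -
    have "Z (Suc m) = {x + y | x y. x \<in> Z m \<and> y \<in> closed_segment (a m) (b m)}"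
      unfolding eq set_plus_def by blast
    then show ?thesis using compact_sums[of "Z m" "closed_segment (a m) (b m)"] Suc c by simp
  qed
  moreover have "Z (Suc m) \<noteq> {}" using Suc c unfolding eq set_plus_def by blast
  moreover have "support_fn (Z (Suc m)) x = (\<Sum>i<Suc m. max (x \<bullet> a i) (x \<bullet> b i))"
    unfolding eq using Suc c by (simp add: support_fn_plus support_fn_closed_segment)
  ultimately show ?case by blast
qed

lemma abs_support_fn_le:
  fixes K :: "'a::euclidean_space set"
  assumes "compact K" "K \<noteq> {}" "K \<subseteq> cball 0 R" "norm u = 1"
  shows "\<bar>support_fn K u\<bar> \<le> R"
proof -
  obtain y where "y \<in> K" "support_fn K u = u \<bullet> y" using support_fn_attained[OF assms(1,2)] by metis
  then show ?thesis using assms(3,4) Cauchy_Schwarz_ineq2[of u y] by (auto intro: order.trans)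
qed

lemma abs_diff_support_fn_le_hausdorff:
  fixes K L :: "'a::euclidean_space set"
  assumes K: "compact K" "K \<noteq> {}" and L: "compact L" "L \<noteq> {}" and u: "norm u = 1"
  shows "\<bar>support_fn K u - support_fn L u\<bar> \<le> hausdorff_metric K L"
proof -
  obtain R where R: "K \<subseteq> cball 0 R"
    using compact_imp_bounded[OF K(1)] unfolding bounded_iff by (auto simp: subset_iff)
  obtain R' where R': "L \<subseteq> cball 0 R'"
    using compact_imp_bounded[OF L(1)] unfolding bounded_iff by (auto simp: subset_iff)
  have "bdd_above ((\<lambda>u. \<bar>support_fn K u - support_fn L u\<bar>) ` sphere 0 1)"
  proof (rule bdd_aboveI2)
    fix v :: 'a assume "v \<in> sphere 0 1"
    then have "norm v = 1" by simp
    then show "\<bar>support_fn K v - support_fn L v\<bar> \<le> R + R'"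
      using abs_support_fn_le[OF K R, of v] abs_support_fn_le[OF L R', of v] by linarith
  qed
  then show ?thesis unfolding hausdorff_metric_def using u by (intro cSUP_upper) auto
qed

lemma hausdorff_metric_le:
  fixes K L :: "'a::euclidean_space set"
  assumes "\<And>u. norm u = 1 \<Longrightarrow> \<bar>support_fn K u - support_fn L u\<bar> \<le> t"
  shows "hausdorff_metric K L \<le> t"
  unfolding hausdorff_metric_def using assms by (intro cSUP_least) auto

text \<open>The approximating zonotopes need not be symmetric, so they are symmetrised: averaging
  \<open>max (u \<bullet> a) (u \<bullet> b)\<close> over \<open>u\<close> and \<open>- u\<close> gives \<open>\<bar>u \<bullet> (a - b)\<bar> / 2\<close>, while the even function
  \<open>support_fn K\<close> does not change.\<close>

lemma symmetric_zonoid_approx: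
  fixes K :: "'a::euclidean_space set"
  assumes K: "K \<in> symmetric_zonoids_in_ball" and \<delta>: "0 < \<delta>"
  shows "\<exists>xs. \<forall>u. norm u = 1 \<longrightarrow> \<bar>support_fn K u - segment_sum xs u\<bar> \<le> \<delta>"
proof -
  have cK: "compact K" "K \<noteq> {}" and sym: "uminus ` K = K"
    using K by (auto simp: symmetric_zonoids_in_ball_def zonoid_def)
  obtain Z where Z: "\<And>i. zonotope (Z i)" "(\<lambda>i. hausdorff_metric (Z i) K) \<longlonglongrightarrow> 0"
    using K by (auto simp: symmetric_zonoids_in_ball_def zonoid_def)
  have "eventually (\<lambda>i. hausdorff_metric (Z i) K < \<delta>) sequentially" using Z(2) \<delta> by (rule order_tendstoD)
  then obtain i where i: "hausdorff_metric (Z i) K < \<delta>" by (auto simp: eventually_sequentially)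
  obtain m a b where Zi: "Z i = (\<Sum>j<(m::nat). closed_segment (a j) (b j))"
    using Z(1)[of i] unfolding zonotope_def by blast
  note sup = support_fn_sum_segments[of a b m, folded Zi]
  have even: "support_fn K (- u) = support_fn K u" for u
  proof -
    have "support_fn K (- u) = (SUP y\<in>uminus ` K. (- u) \<bullet> y)" unfolding support_fn_def sym ..
    also have "\<dots> = support_fn K u" unfolding support_fn_def image_image by simp
    finally show ?thesis .
  qed
  define xs where "xs = map (\<lambda>j. (1 / 2) *\<^sub>R (a j - b j)) [0..<m]"
  have "\<bar>support_fn K u - segment_sum xs u\<bar> \<le> \<delta>" if u: "norm u = 1" for u
  proof -
    have half: "\<bar>u \<bullet> ((1 / 2) *\<^sub>R (a j - b j))\<bar> = (max (u \<bullet> a j) (u \<bullet> b j) + max (- u \<bullet> a j) (- u \<bullet> b j)) / 2" for j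
      by (auto simp: inner_diff_right max_def abs_if field_simps)
    have "segment_sum xs u = (\<Sum>j<m. (max (u \<bullet> a j) (u \<bullet> b j) + max (- u \<bullet> a j) (- u \<bullet> b j)) / 2)"
      unfolding segment_sum_def xs_def sum_list_eq_sum_nth by (simp only: half[symmetric]) simp
    also have "\<dots> = (support_fn (Z i) u + support_fn (Z i) (- u)) / 2"
      using sup[of u] sup[of "- u"] by (simp add: sum_divide_distrib[symmetric] sum.distrib)
    finally have "support_fn K u - segment_sum xs u =
        ((support_fn K u - support_fn (Z i) u) + (support_fn K (- u) - support_fn (Z i) (- u))) / 2"
      using even by simp
    moreover have "\<bar>support_fn (Z i) v - support_fn K v\<bar> \<le> \<delta>" if "norm v = 1" for v
      using abs_diff_support_fn_le_hausdorff[of "Z i" K v] sup cK that i by force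
    from this[of u] this[of "- u"] have "\<bar>support_fn (Z i) u - support_fn K u\<bar> \<le> \<delta>"
      "\<bar>support_fn (Z i) (- u) - support_fn K (- u)\<bar> \<le> \<delta>" using u by auto
    moreover have "\<bar>e\<bar> \<le> \<delta>" if "e = ((x - y) + (x' - y')) / 2" "\<bar>y - x\<bar> \<le> \<delta>" "\<bar>y' - x'\<bar> \<le> \<delta>"
      for e x y x' y' :: real
      using that by (simp add: abs_le_iff)
    ultimately show ?thesis by blast
  qed
  then show ?thesis by blast
qed

section \<open>Nets of directions and lattice codes\<close>

lemma abs_inner_le:
  fixes u x :: "'a::euclidean_space" and A B :: real
  assumes "\<And>c. c \<in> Basis \<Longrightarrow> \<bar>u \<bullet> c\<bar> \<le> A" "\<And>c. c \<in> Basis \<Longrightarrow> \<bar>x \<bullet> c\<bar> \<le> B"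
  shows "\<bar>u \<bullet> x\<bar> \<le> DIM('a) * (A * B)"
proof -
  obtain c0 :: 'a where c0: "c0 \<in> Basis" by (meson all_not_in_conv nonempty_Basis)
  have A: "0 \<le> A" using assms(1)[OF c0] by linarith
  have "\<bar>u \<bullet> x\<bar> = \<bar>\<Sum>c\<in>Basis. (u \<bullet> c) * (x \<bullet> c)\<bar>" by (simp only: euclidean_inner[of u x])
  also have "\<dots> \<le> (\<Sum>c\<in>(Basis::'a set). A * B)"
  proof (rule order.trans[OF sum_abs sum_mono])
    fix c :: 'a assume "c \<in> Basis"
    then show "\<bar>(u \<bullet> c) * (x \<bullet> c)\<bar> \<le> A * B" unfolding abs_mult using assms A by (intro mult_mono) auto
  qed
  finally show ?thesis by simp
qed

lemma segment_sum_lipschitz: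
  fixes xs :: "'a::euclidean_space list" and D :: real
  assumes D: "\<And>c. c \<in> Basis \<Longrightarrow> \<bar>(u - v) \<bullet> c\<bar> \<le> D"
  shows "\<bar>segment_sum xs u - segment_sum xs v\<bar> \<le> DIM('a) * D * total_size xs"
proof (induction xs)
  case (Cons x xs)
  have "\<bar>\<bar>u \<bullet> x\<bar> - \<bar>v \<bullet> x\<bar>\<bar> \<le> \<bar>(u - v) \<bullet> x\<bar>" unfolding inner_diff_left by (rule abs_triangle_ineq3)
  also have "\<dots> \<le> DIM('a) * (D * infnorm x)" using D abs_inner_le_infnorm by (intro abs_inner_le) auto
  finally have "\<bar>\<bar>u \<bullet> x\<bar> - \<bar>v \<bullet> x\<bar>\<bar> \<le> DIM('a) * D * infnorm x" by (simp add: mult.assoc)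
  moreover have "DIM('a) * D * total_size (x # xs) = DIM('a) * D * infnorm x + DIM('a) * D * total_size xs"
    by (simp add: total_size_def distrib_left)
  moreover have "segment_sum (x # xs) w = \<bar>w \<bullet> x\<bar> + segment_sum xs w" for w by (simp add: segment_sum_def)
  ultimately show ?case using Cons.IH by simp
qed (simp add: segment_sum_def total_size_def)

text \<open>This controls the size of a zonotope by the values of its support function at the basis
  vectors, and so by a constant for all zonotopes that are close to a subset of the unit ball.\<close>

lemma total_size_le_sum_Basis:
  fixes xs :: "'a::euclidean_space list"
  shows "total_size xs \<le> (\<Sum>c\<in>Basis. segment_sum xs c)"
proof (induction xs)
  case (Cons x xs)
  obtain b where b: "b \<in> Basis" "\<bar>x \<bullet> b\<bar> = infnorm x" using infnorm_attained[of x] by blast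
  have "infnorm x \<le> (\<Sum>c\<in>Basis. \<bar>x \<bullet> c\<bar>)"
    using member_le_sum[of b Basis "\<lambda>c. \<bar>x \<bullet> c\<bar>"] b by simp
  then show ?case using Cons by (simp add: total_size_def segment_sum_def sum.distrib inner_commute)
qed (simp add: total_size_def segment_sum_def)

definition grid_point :: "real \<Rightarrow> ('a \<Rightarrow> int) \<Rightarrow> 'a::euclidean_space" where
  "grid_point \<delta> k = (\<Sum>c\<in>Basis. (\<delta> * k c) *\<^sub>R c)"

lemma grid_point_inner: "c \<in> Basis \<Longrightarrow> grid_point \<delta> k \<bullet> c = \<delta> * k c"
  unfolding grid_point_def by (simp add: inner_sum_left_Basis)

lemma grid_point_floor:
  assumes "0 < \<delta>" "c \<in> Basis"
  shows "\<bar>(x - grid_point \<delta> (\<lambda>c. \<lfloor>x \<bullet> c / \<delta>\<rfloor>)) \<bullet> c\<bar> \<le> \<delta>"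
proof -
  define f where "f = \<lfloor>x \<bullet> c / \<delta>\<rfloor>"
  have f: "f \<le> x \<bullet> c / \<delta>" "x \<bullet> c / \<delta> < f + 1" unfolding f_def by linarith+
  then have "\<delta> * f \<le> x \<bullet> c" "x \<bullet> c < \<delta> * f + \<delta>" using assms(1) by (simp_all add: field_simps)
  then show ?thesis using assms(2) by (simp add: inner_diff_left grid_point_inner f_def[symmetric])
qed

text \<open>The grid points need not lie on the sphere; it suffices that their coordinates are bounded by one.\<close>

lemma ex_boxed_net:
  assumes p: "0 < (p::nat)"
  shows "\<exists>U::'a::euclidean_space set. boxed U \<and> card U \<le> (2 * p + 1) ^ DIM('a) \<and>
    (\<forall>u. norm u = 1 \<longrightarrow> (\<exists>v\<in>U. \<forall>c\<in>Basis. \<bar>(u - v) \<bullet> c\<bar> \<le> 1 / p))"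
proof -
  define U :: "'a set" where "U = grid_point (1 / p) ` (Basis \<rightarrow>\<^sub>E {- int p..int p})"
  have fin: "finite ((Basis::'a set) \<rightarrow>\<^sub>E {- int p..int p})" by (intro finite_PiE) auto
  have "card U \<le> card ((Basis::'a set) \<rightarrow>\<^sub>E {- int p..int p})" unfolding U_def using fin by (rule card_image_le)
  also have "\<dots> = (2 * p + 1) ^ DIM('a)" by (subst card_PiE) (auto simp: nat_add_distrib nat_mult_distrib)
  finally have c: "card U \<le> (2 * p + 1) ^ DIM('a)" .
  have net: "\<exists>v\<in>U. \<forall>c\<in>Basis. \<bar>(u - v) \<bullet> c\<bar> \<le> 1 / p" if u: "norm u = 1" for u :: 'a
  proof -
    define k where "k = restrict (\<lambda>c. \<lfloor>u \<bullet> c / (1 / p)\<rfloor>) Basis"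
    have "k \<in> Basis \<rightarrow>\<^sub>E {- int p..int p}"
    proof
      fix c :: 'a assume c: "c \<in> Basis"
      have "\<bar>u \<bullet> c\<bar> \<le> 1" using Basis_le_norm[OF c, of u] u by simp
      then have "- real p \<le> u \<bullet> c * p" "u \<bullet> c * p \<le> real p"
        using mult_right_mono[of "- 1" "u \<bullet> c" "real p"] mult_right_mono[of "u \<bullet> c" 1 "real p"] by auto
      then have "- int p \<le> \<lfloor>u \<bullet> c * p\<rfloor>" "\<lfloor>u \<bullet> c * p\<rfloor> \<le> int p"
        by (auto simp: le_floor_iff floor_le_iff)
      then show "k c \<in> {- int p..int p}" using c by (simp add: k_def)
    qed (simp add: k_def)
    moreover have "grid_point (1 / p) k = grid_point (1 / p) (\<lambda>c. \<lfloor>u \<bullet> c / (1 / p)\<rfloor>)"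
      unfolding grid_point_def k_def by (intro sum.cong) auto
    ultimately have "grid_point (1 / p) (\<lambda>c. \<lfloor>u \<bullet> c / (1 / p)\<rfloor>) \<in> U"
      unfolding U_def by (metis image_eqI)
    then show ?thesis using grid_point_floor[of "1 / real p" _ u] p by (intro bexI) auto
  qed
  have "boxed U" unfolding boxed_def
  proof (intro conjI ballI)
    show "finite U" unfolding U_def using fin by simp
    obtain b :: 'a where "b \<in> Basis" by (meson all_not_in_conv nonempty_Basis)
    then show "U \<noteq> {}" using net[of b] by auto
    fix u c :: 'a assume "u \<in> U" and c: "c \<in> Basis"
    then obtain k where k: "k \<in> Basis \<rightarrow>\<^sub>E {- int p..int p}" "u = grid_point (1 / p) k" by (auto simp: U_def)
    then have "k c \<in> {- int p..int p}" using c by auto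
    then have "\<bar>real_of_int (k c)\<bar> \<le> p" by auto
    then show "\<bar>u \<bullet> c\<bar> \<le> 1" using k(2) c p by (simp add: grid_point_inner abs_mult)
  qed
  with c net show ?thesis by blast
qed

text \<open>The list is padded to length \<open>N\<close> with zero vectors, whose code is zero, and every coordinate
  is rounded down to a multiple of \<open>\<delta>\<close>.\<close>

lemma ex_lattice_code:
  fixes ys :: "'a::euclidean_space list" and W \<delta> :: real
  assumes len: "length ys \<le> N" and W: "\<And>y. y \<in> set ys \<Longrightarrow> infnorm y \<le> W" and \<delta>: "0 < \<delta>" and R: "W / \<delta> + 1 \<le> real R"
  shows "\<exists>k \<in> ({..<N} \<times> Basis) \<rightarrow>\<^sub>E {- int R..int R}. \<forall>u. (\<forall>c\<in>Basis. \<bar>u \<bullet> c\<bar> \<le> 1) \<longrightarrow>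
    \<bar>segment_sum ys u - segment_sum (map (\<lambda>i. grid_point \<delta> (\<lambda>c. k (i, c))) [0..<N]) u\<bar> \<le> N * (DIM('a) * \<delta>)"
proof -
  define y where "y = (\<lambda>i. if i < length ys then ys ! i else 0)"
  define k where "k = restrict (\<lambda>(i, c). \<lfloor>y i \<bullet> c / \<delta>\<rfloor>) ({..<N} \<times> Basis)"
  have "k \<in> ({..<N} \<times> Basis) \<rightarrow>\<^sub>E {- int R..int R}"
  proof
    fix z :: "nat \<times> 'a" assume z: "z \<in> {..<N} \<times> Basis"
    then obtain i c where ic: "z = (i, c)" "c \<in> Basis" by auto
    show "k z \<in> {- int R..int R}"
    proof (cases "i < length ys")
      case True
      then have "\<bar>y i \<bullet> c\<bar> \<le> W"
        using abs_inner_le_infnorm[OF ic(2), of "ys ! i"] W[of "ys ! i"] by (simp add: y_def)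
      then have "\<bar>y i \<bullet> c / \<delta>\<bar> \<le> W / \<delta>" using \<delta> by (simp add: divide_right_mono)
      then have "\<bar>y i \<bullet> c / \<delta>\<bar> \<le> real R - 1" using R by linarith
      then have "- int R \<le> \<lfloor>y i \<bullet> c / \<delta>\<rfloor>" "\<lfloor>y i \<bullet> c / \<delta>\<rfloor> \<le> int R" by linarith+
      then show ?thesis using z ic by (simp add: k_def)
    next
      case False
      then show ?thesis using z ic by (simp add: k_def y_def)
    qed
  qed (auto simp: k_def)
  moreover have "\<bar>segment_sum ys u - segment_sum (map (\<lambda>i. grid_point \<delta> (\<lambda>c. k (i, c))) [0..<N]) u\<bar> \<le> N * (DIM('a) * \<delta>)"
    if u: "\<And>c. c \<in> Basis \<Longrightarrow> \<bar>u \<bullet> c\<bar> \<le> 1" for u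
  proof -
    define g where "g = (\<lambda>i. grid_point \<delta> (\<lambda>c. k (i, c)))"
    have gi: "g i = grid_point \<delta> (\<lambda>c. \<lfloor>y i \<bullet> c / \<delta>\<rfloor>)" if "i < N" for i
      unfolding g_def grid_point_def k_def using that by (intro sum.cong) auto
    have "segment_sum ys u = (\<Sum>i<N. \<bar>u \<bullet> y i\<bar>)"
    proof -
      have "segment_sum ys u = (\<Sum>i<length ys. \<bar>u \<bullet> y i\<bar>)"
        unfolding segment_sum_def sum_list_eq_sum_nth by (intro sum.cong) (auto simp: y_def)
      also have "\<dots> = (\<Sum>i<N. \<bar>u \<bullet> y i\<bar>)" using len by (intro sum.mono_neutral_left) (auto simp: y_def)
      finally show ?thesis .
    qed
    moreover have "segment_sum (map g [0..<N]) u = (\<Sum>i<N. \<bar>u \<bullet> g i\<bar>)"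
      unfolding segment_sum_def sum_list_eq_sum_nth by simp
    ultimately have "segment_sum ys u - segment_sum (map g [0..<N]) u = (\<Sum>i<N. \<bar>u \<bullet> y i\<bar> - \<bar>u \<bullet> g i\<bar>)"
      by (simp add: sum_subtractf)
    also have "\<bar>\<dots>\<bar> \<le> (\<Sum>i<N. DIM('a) * \<delta>)"
    proof (rule order.trans[OF sum_abs sum_mono])
      fix i assume "i \<in> {..<N}"
      then have i: "i < N" by simp
      have "\<bar>\<bar>u \<bullet> y i\<bar> - \<bar>u \<bullet> g i\<bar>\<bar> \<le> \<bar>u \<bullet> (y i - g i)\<bar>"
        unfolding inner_diff_right by (rule abs_triangle_ineq3)
      also have "\<dots> \<le> DIM('a) * (1 * \<delta>)"
        unfolding gi[OF i] using u grid_point_floor[OF \<delta>, of _ "y i"] by (intro abs_inner_le) auto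
      finally show "\<bar>\<bar>u \<bullet> y i\<bar> - \<bar>u \<bullet> g i\<bar>\<bar> \<le> DIM('a) * \<delta>" by simp
    qed
    finally show ?thesis unfolding g_def by simp
  qed
  ultimately show ?thesis by (intro bexI[of _ k]) auto
qed

text \<open>Nets have to consist of points of \<open>S\<close>, whereas codes describe points outside \<open>S\<close>. Choosing for each
  code that occurs one point of \<open>S\<close> close to it produces such a net.\<close>

lemma net_entropy_le_ln_card_codes:
  assumes Y: "finite Y" "Y \<noteq> {}" and code: "\<And>x. x \<in> S \<Longrightarrow> \<exists>y\<in>Y. close x y"
    and close: "\<And>x x' y. x \<in> S \<Longrightarrow> x' \<in> S \<Longrightarrow> y \<in> Y \<Longrightarrow> close x y \<Longrightarrow> close x' y \<Longrightarrow> d x x' \<le> t"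
  shows "net_entropy d t S \<le> ereal (ln (card Y))"
proof -
  define Y' where "Y' = {y\<in>Y. \<exists>x\<in>S. close x y}"
  define rep where "rep = (\<lambda>y. SOME x. x \<in> S \<and> close x y)"
  have rep: "rep y \<in> S \<and> close (rep y) y" if "y \<in> Y'" for y
  proof -
    have "\<exists>x. x \<in> S \<and> close x y" using that unfolding Y'_def by blast
    then show ?thesis unfolding rep_def by (rule someI_ex)
  qed
  define V where "V = rep ` Y'"
  have fin: "finite V" using Y by (simp add: V_def Y'_def)
  have "card V \<le> card Y'" unfolding V_def using Y by (intro card_image_le) (simp add: Y'_def)
  also have "\<dots> \<le> card Y" using Y by (intro card_mono) (auto simp: Y'_def)
  finally have cV: "card V \<le> card Y" .
  have "is_net d t S V"
    unfolding is_net_def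
  proof (intro conjI ballI)
    show "V \<subseteq> S" using rep by (auto simp: V_def)
    fix x assume x: "x \<in> S"
    then obtain y where y: "y \<in> Y" "close x y" using code by blast
    then have "y \<in> Y'" using x by (auto simp: Y'_def)
    then have "rep y \<in> V" "d x (rep y) \<le> t"
      using close[OF x _ y, of "rep y"] rep[of y] by (simp_all add: V_def)
    then show "\<exists>v\<in>V. d x v \<le> t" by blast
  qed
  then have "covering_number d t S \<le> (if finite V then enat (card V) else \<infinity>)"
    unfolding covering_number_def by (intro INF_lower) simp
  also have "\<dots> \<le> enat (card Y)" using fin cV by simp
  finally have le: "covering_number d t S \<le> enat (card Y)" .
  then obtain N where N: "covering_number d t S = enat N" using enat_ile by blast
  with le have NY: "N \<le> card Y" by simp
  have "ln (real N) \<le> ln (real (card Y))"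
  proof (cases "N = 0")
    case True
    have "1 \<le> real (card Y)" using Y by (simp add: Suc_le_eq card_gt_0_iff)
    then show ?thesis using True by simp
  next
    case False
    then show ?thesis using NY by (intro ln_mono) auto
  qed
  then show ?thesis using N by (simp add: net_entropy_def)
qed

section \<open>The entropy of the space of zonoids\<close>

text \<open>Four errors of at most \<open>t / 8\<close> each lie between the support function of a zonoid and its code: the
  zonotope approximation, the reduction to \<open>N\<close> segments on \<open>U\<close>, the passage from \<open>U\<close> to the whole
  sphere, and the rounding to a lattice. Two zonoids with the same code are then at distance at most \<open>t\<close>.\<close>

lemma net_entropy_zonoids_le:
  fixes t W D \<delta> :: real and U :: "'a::euclidean_space set"
  assumes t: "0 < t" "t \<le> 4" and W: "W = 2 * DIM('a)"
    and net: "\<And>u. norm u = 1 \<Longrightarrow> \<exists>v\<in>U. \<forall>c\<in>Basis. \<bar>(u - v) \<bullet> c\<bar> \<le> D" and D: "0 \<le> D" "2 * (DIM('a) * D * W) \<le> t / 8"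
    and few: "\<And>xs. total_size xs \<le> W \<Longrightarrow> \<exists>ys. length ys \<le> N \<and> total_size ys \<le> W \<and>
      (\<forall>u\<in>U. \<bar>segment_sum xs u - segment_sum ys u\<bar> \<le> t / 8)"
    and \<delta>: "0 < \<delta>" "N * (DIM('a) * \<delta>) \<le> t / 8" and R: "W / \<delta> + 1 \<le> real R"
  shows "net_entropy hausdorff_metric t (symmetric_zonoids_in_ball :: 'a set set)
    \<le> ereal (real N * DIM('a) * ln (2 * real R + 1))"
proof -
  define Y where "Y = ({..<N} \<times> (Basis::'a set)) \<rightarrow>\<^sub>E {- int R..int R}"
  define dec where "dec = (\<lambda>k. map (\<lambda>i. grid_point \<delta> (\<lambda>c. k (i, c)) :: 'a) [0..<N])"
  define close where "close = (\<lambda>K k. \<forall>u. norm u = 1 \<longrightarrow> \<bar>support_fn K u - segment_sum (dec k) u\<bar> \<le> t / 2)"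
  have finY: "finite Y" unfolding Y_def by (intro finite_PiE) auto
  have "Y \<noteq> {}" unfolding Y_def by (simp add: PiE_eq_empty_iff)
  have "card {- int R..int R} = 2 * R + 1" by (simp add: nat_add_distrib nat_mult_distrib)
  then have "card Y = (2 * R + 1) ^ (N * DIM('a))"
    unfolding Y_def by (subst card_PiE) (auto simp: card_cartesian_product)
  then have "ln (card Y) = real N * DIM('a) * ln (2 * real R + 1)"
    by (simp add: ln_realpow)
  moreover have "net_entropy hausdorff_metric t (symmetric_zonoids_in_ball :: 'a set set) \<le> ereal (ln (card Y))"
  proof (rule net_entropy_le_ln_card_codes[OF finY \<open>Y \<noteq> {}\<close>, where close = close])
    fix K :: "'a set" assume K: "K \<in> symmetric_zonoids_in_ball"
    have K': "compact K" "K \<noteq> {}" "K \<subseteq> cball 0 1" using K by (auto simp: symmetric_zonoids_in_ball_def zonoid_def)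
    obtain xs where xs: "\<And>u. norm u = 1 \<Longrightarrow> \<bar>support_fn K u - segment_sum xs u\<bar> \<le> t / 8"
      using symmetric_zonoid_approx[OF K, of "t / 8"] t(1) by auto
    have "segment_sum xs c \<le> 2" if "c \<in> Basis" for c
      using xs[OF norm_Basis[OF that]] abs_support_fn_le[OF K' norm_Basis[OF that]] t(2) by linarith
    then have "(\<Sum>c\<in>Basis. segment_sum xs c) \<le> (\<Sum>c\<in>(Basis::'a set). 2)" by (rule sum_mono)
    with total_size_le_sum_Basis[of xs] have xW: "total_size xs \<le> W" by (simp add: W mult.commute)
    obtain ys where ys: "length ys \<le> N" "total_size ys \<le> W"
      "\<And>u. u \<in> U \<Longrightarrow> \<bar>segment_sum xs u - segment_sum ys u\<bar> \<le> t / 8"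
      using few[OF xW] by blast
    have "infnorm y \<le> W" if "y \<in> set ys" for y
    proof -
      have "infnorm y \<le> total_size ys" unfolding total_size_def
        using that infnorm_pos_le by (intro member_le_sum_list) auto
      then show ?thesis using ys(2) by linarith
    qed
    from ex_lattice_code[OF ys(1) this \<delta>(1) R]
    obtain k where kY: "k \<in> Y" and k: "\<forall>u. (\<forall>c\<in>Basis. \<bar>u \<bullet> c\<bar> \<le> 1) \<longrightarrow>
        \<bar>segment_sum ys u - segment_sum (dec k) u\<bar> \<le> N * (DIM('a) * \<delta>)"
      unfolding Y_def dec_def by (rule bexE)
    have "close K k" unfolding close_def
    proof (intro allI impI)
      fix u :: 'a assume u: "norm u = 1"
      obtain v where v: "v \<in> U" "\<And>c. c \<in> Basis \<Longrightarrow> \<bar>(u - v) \<bullet> c\<bar> \<le> D" using net[OF u] by blast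
      have lip: "\<bar>segment_sum zs u - segment_sum zs v\<bar> \<le> DIM('a) * D * W" if "total_size zs \<le> W" for zs
      proof -
        have "\<bar>segment_sum zs u - segment_sum zs v\<bar> \<le> DIM('a) * D * total_size zs"
          using v(2) by (rule segment_sum_lipschitz)
        also have "\<dots> \<le> DIM('a) * D * W" using that D by (intro mult_left_mono) auto
        finally show ?thesis .
      qed
      have "\<bar>u \<bullet> c\<bar> \<le> 1" if "c \<in> Basis" for c using Basis_le_norm[OF that, of u] u by simp
      then have "\<bar>segment_sum ys u - segment_sum (dec k) u\<bar> \<le> N * (DIM('a) * \<delta>)" using k by simp
      then have "\<bar>segment_sum ys u - segment_sum (dec k) u\<bar> \<le> t / 8" using \<delta>(2) by linarith
      then show "\<bar>support_fn K u - segment_sum (dec k) u\<bar> \<le> t / 2"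
        using xs[OF u] ys(3)[OF v(1)] lip[OF xW] lip[OF ys(2)] D(2) by linarith
    qed
    then show "\<exists>k\<in>Y. close K k" using kY by blast
  next
    fix K L :: "'a set" and k
    assume "close K k" "close L k"
    then show "hausdorff_metric K L \<le> t" unfolding close_def
      by (intro hausdorff_metric_le) (smt (verit) field_sum_of_halves)
  qed
  ultimately show ?thesis by simp
qed

lemma ex_ln_bound:
  fixes A \<beta> e :: real
  assumes "1 \<le> A" "0 < \<beta>" "0 < e"
  shows "\<exists>C>0. \<forall>t. 0 < t \<and> t < 1 \<longrightarrow> ln (A * t powr (- \<beta>)) \<le> C * t powr (- e)"
proof -
  define a where "a = e / \<beta>"
  have a: "0 < a" using assms by (simp add: a_def)
  have "ln (A * t powr (- \<beta>)) \<le> (A powr a / a) * t powr (- e)" if t: "0 < t" "t < 1" for t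
  proof -
    have "t powr 0 \<le> t powr (- \<beta>)" using t assms by (intro powr_mono') auto
    then have "1 * 1 \<le> A * t powr (- \<beta>)" using assms t by (intro mult_mono) auto
    then have "ln (A * t powr (- \<beta>)) \<le> (A * t powr (- \<beta>)) powr a / a"
      using a by (intro ln_powr_bound) auto
    also have "\<dots> = (A powr a / a) * t powr (- e)"
      using assms t by (simp add: powr_mult powr_powr a_def)
    finally show ?thesis .
  qed
  then show ?thesis using a assms by (intro exI[of _ "A powr a / a"]) auto
qed

text \<open>At \<open>\<epsilon> = 0\<close> the left-hand side equals \<open>2 * (n - 1) / (n + 2)\<close>, and it depends continuously on \<open>\<epsilon>\<close>.\<close>

lemma ex_small_exponent_loss:
  fixes n \<eta> :: real
  assumes n: "1 < n" and \<eta>: "0 < \<eta>"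
  shows "\<exists>\<epsilon>>0. \<epsilon> < 1 / (n - 1) \<and>
    (1 + 2 * \<epsilon>) / (1 / 2 + 3 / 2 * (1 / (n - 1) - \<epsilon>)) + \<epsilon> \<le> 2 * (n - 1) / (n + 2) + \<eta>"
proof -
  define f where "f = (\<lambda>\<epsilon>. (1 + 2 * \<epsilon>) / (1 / 2 + 3 / 2 * (1 / (n - 1) - \<epsilon>)) + \<epsilon>)"
  have pos: "0 < 1 / 2 + 3 / 2 * (1 / (n - 1))" using n by (intro add_pos_pos mult_pos_pos) auto
  have "1 / 2 + 3 / 2 * (1 / (n - 1)) = (n + 2) / (2 * (n - 1))" using n by (simp add: field_simps)
  note eq = this
  have "f 0 = 1 / (1 / 2 + 3 / 2 * (1 / (n - 1)))"
    unfolding f_def by (simp only: mult_zero_right add_0_right diff_zero)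
  then have f0: "f 0 = 2 * (n - 1) / (n + 2)" unfolding eq by simp
  have "isCont f 0" unfolding f_def using pos by (intro continuous_intros) auto
  then have "(f \<longlongrightarrow> f 0) (at_right 0)"
    unfolding isCont_def by (rule filterlim_at_split[THEN iffD1, THEN conjunct2])
  then have "eventually (\<lambda>\<epsilon>. f \<epsilon> < 2 * (n - 1) / (n + 2) + \<eta>) (at_right 0)"
    using \<eta> f0 by (intro order_tendstoD(2)[where y = "f 0"]) auto
  moreover have "eventually (\<lambda>\<epsilon>. 0 < \<epsilon> \<and> \<epsilon> < 1 / (n - 1)) (at_right (0::real))"
    using n by (auto simp: eventually_at_right_field intro!: exI[of _ "1 / (n - 1)"])
  ultimately have "eventually (\<lambda>\<epsilon>. f \<epsilon> < 2 * (n - 1) / (n + 2) + \<eta> \<and> 0 < \<epsilon> \<and> \<epsilon> < 1 / (n - 1)) (at_right 0)"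
    by (rule eventually_conj)
  then obtain \<epsilon> where "f \<epsilon> < 2 * (n - 1) / (n + 2) + \<eta> \<and> 0 < \<epsilon> \<and> \<epsilon> < 1 / (n - 1)"
    using eventually_happens'[OF trivial_limit_at_right_real] by blast
  then show ?thesis unfolding f_def by (intro exI[of _ \<epsilon>]) auto
qed

text \<open>With \<open>N\<close> of order \<open>t powr (- \<alpha>)\<close>, where \<open>\<alpha> = (1 + 2 * \<epsilon>) / \<gamma>\<close>, the reduction to \<open>N\<close> segments has error
  at most \<open>t / 8\<close>; the term \<open>2 * \<epsilon>\<close> pays for the squared logarithm of the size of the net of directions. The
  entropy is \<open>N\<close> times a logarithm, which costs one more \<open>\<epsilon>\<close>.\<close>

lemma net_entropy_zonoids_asymptotic:
  fixes \<eta> :: real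
  defines "n \<equiv> real DIM('a::euclidean_space)"
  assumes n: "2 \<le> DIM('a)" and \<eta>: "0 < \<eta>"
  shows "\<exists>c::real. \<forall>t::real. 0 < t \<and> t < 1/2 \<longrightarrow>
    net_entropy hausdorff_metric t (symmetric_zonoids_in_ball :: 'a set set)
      \<le> ereal (c * t powr (- (2 * (n - 1) / (n + 2)) - \<eta>))"
proof -
  have n2: "2 \<le> n" using n by (simp add: n_def)
  define W where "W = 2 * n"
  have W: "0 < W" using n2 by (simp add: W_def)
  obtain \<epsilon> where \<epsilon>: "0 < \<epsilon>" "\<epsilon> < 1 / (n - 1)"
    and ex: "(1 + 2 * \<epsilon>) / (1 / 2 + 3 / 2 * (1 / (n - 1) - \<epsilon>)) + \<epsilon> \<le> 2 * (n - 1) / (n + 2) + \<eta>"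
    using ex_small_exponent_loss[of n \<eta>] n2 \<eta> by auto
  define \<gamma> where "\<gamma> = 1 / 2 + 3 / 2 * (1 / (n - 1) - \<epsilon>)"
  have \<gamma>: "0 < \<gamma>" using \<epsilon> unfolding \<gamma>_def by (intro add_pos_nonneg mult_nonneg_nonneg) auto
  define \<alpha> where "\<alpha> = (1 + 2 * \<epsilon>) / \<gamma>"
  have \<alpha>: "0 < \<alpha>" "\<alpha> + \<epsilon> \<le> 2 * (n - 1) / (n + 2) + \<eta>" using \<epsilon> \<gamma> ex by (auto simp: \<alpha>_def \<gamma>_def)
  obtain C M0 where C: "0 < C" "1 \<le> M0" and few: "\<And>N (U::'a set) xs. M0 \<le> N \<Longrightarrow> boxed U \<Longrightarrow> total_size xs \<le> W \<Longrightarrow>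
    \<exists>ys. real (length ys) \<le> N \<and> total_size ys \<le> W \<and>
      (\<forall>u\<in>U. \<bar>segment_sum xs u - segment_sum ys u\<bar> \<le> C * (log_card U)\<^sup>2 * N powr (- \<gamma>))"
    using ex_few_segments[where 'a = 'a, OF n \<epsilon>[unfolded n_def] W, folded n_def, folded \<gamma>_def] by (elim exE conjE) simp
  define A where "A = 64 * n * W + 3"
  have "0 \<le> n * W" "0 \<le> W * n" using n2 W by simp_all
  then have A: "1 \<le> A" "32 * n * W + 3 \<le> A" by (simp_all add: A_def)
  obtain C1 where C1: "0 < C1" "\<And>t. 0 < t \<Longrightarrow> t < 1 \<Longrightarrow> ln (A * t powr (- 1)) \<le> C1 * t powr (- \<epsilon>)"
    using ex_ln_bound[OF A(1), of 1 \<epsilon>] \<epsilon>(1) by auto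
  define C2 where "C2 = n * C1 + 2"
  have C2: "0 < C2" using C1 n2 by (simp add: C2_def add_pos_pos)
  \<comment> \<open>The second entry makes the approximation error at most \<open>t / 8\<close>.\<close>
  define K where "K = max M0 ((8 * C * C2\<^sup>2) powr (1 / \<gamma>))"
  have K1: "1 \<le> K" using C by (simp add: K_def)
  have Kp: "8 * C * C2\<^sup>2 \<le> K powr \<gamma>"
  proof -
    have "((8 * C * C2\<^sup>2) powr (1 / \<gamma>)) powr \<gamma> \<le> K powr \<gamma>" using \<gamma> by (intro powr_mono2) (auto simp: K_def)
    then show ?thesis using \<gamma> C C2 by (simp add: powr_powr)
  qed
  define A' where "A' = 16 * n * W * K + 5"
  have "0 \<le> n * W * K" using n2 W K1 by simp
  then have A': "1 \<le> A'" by (simp add: A'_def)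
  obtain C3 where C3: "0 < C3" "\<And>t. 0 < t \<Longrightarrow> t < 1 \<Longrightarrow> ln (A' * t powr (- (\<alpha> + 1))) \<le> C3 * t powr (- \<epsilon>)"
    using ex_ln_bound[OF A', of "\<alpha> + 1" \<epsilon>] \<epsilon>(1) \<alpha>(1) by auto
  have "net_entropy hausdorff_metric t (symmetric_zonoids_in_ball :: 'a set set)
      \<le> ereal (K * n * C3 * t powr (- (2 * (n - 1) / (n + 2)) - \<eta>))" if t: "0 < t" "t < 1/2" for t
  proof -
    have ge1: "1 \<le> t powr (- x)" if "0 \<le> x" for x
      using powr_mono'[of "- x" 0 t] t that by auto
    define p where "p = nat \<lceil>16 * n * W / t\<rceil>"
    have "0 < 16 * n * W / t" using n2 W t by simp
    then have p: "16 * n * W / t \<le> p" "p \<le> 16 * n * W / t + 1" "0 < p" unfolding p_def by linarith+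
    obtain U :: "'a set" where U: "boxed U" "card U \<le> (2 * p + 1) ^ DIM('a)"
      "\<And>u. norm u = 1 \<Longrightarrow> \<exists>v\<in>U. \<forall>c\<in>Basis. \<bar>(u - v) \<bullet> c\<bar> \<le> 1 / p"
      using ex_boxed_net[OF p(3), where 'a = 'a] by blast
    have \<Lambda>: "log_card U \<le> C2 * t powr (- \<epsilon>)"
    proof -
      have cU: "1 \<le> real (card U)" using U(1) by (simp add: boxed_def Suc_le_eq card_gt_0_iff)
      have "real (card U) \<le> real ((2 * p + 1) ^ DIM('a))" using U(2) by (simp only: of_nat_le_iff)
      then have "real (card U) \<le> (2 * real p + 1) ^ DIM('a)" by (simp add: add.commute)
      then have "ln (real (card U)) \<le> ln ((2 * real p + 1) ^ DIM('a))" using cU by (intro ln_mono) auto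
      also have "\<dots> = n * ln (2 * real p + 1)" by (simp add: ln_realpow n_def)
      also have "\<dots> \<le> n * ln (A * t powr (- 1))"
      proof -
        have "2 * real p + 1 \<le> 32 * n * W / t + 3" using p(2) by simp
        also have "\<dots> \<le> (32 * n * W + 3) / t" 
        proof -
          have "3 \<le> 3 / t" using t by (simp add: le_divide_eq)
          then show ?thesis by (simp add: add_divide_distrib)
        qed
        also have "\<dots> \<le> A / t" using A(2) t by (intro divide_right_mono) auto
        also have "\<dots> = A * t powr (- 1)" using t by (simp add: powr_minus_divide)
        finally show ?thesis using n2 by (intro mult_left_mono ln_mono) auto
      qed
      also have "\<dots> \<le> n * (C1 * t powr (- \<epsilon>))" using C1(2)[of t] t n2 by (intro mult_left_mono) auto
      finally have 1: "ln (real (card U)) \<le> n * (C1 * t powr (- \<epsilon>))" .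
      have "ln (2 * real (card U)) = ln 2 + ln (real (card U))" using cU by (simp add: ln_mult)
      moreover have "ln (2::real) \<le> 1" using ln_le_minus_one[of "2::real"] by simp
      moreover have "2 \<le> 2 * t powr (- \<epsilon>)" using ge1[of \<epsilon>] \<epsilon>(1) by simp
      ultimately have "log_card U \<le> n * (C1 * t powr (- \<epsilon>)) + 2 * t powr (- \<epsilon>)"
        using 1 unfolding log_card_def by linarith
      then show ?thesis by (simp add: C2_def algebra_simps)
    qed
    define N where "N = K * t powr (- \<alpha>)"
    have tal: "1 \<le> t powr (- \<alpha>)" using ge1[of \<alpha>] \<alpha>(1) by simp
    have KN: "K \<le> N" using mult_left_mono[OF tal, of K] K1 by (simp add: N_def)
    have NM: "M0 \<le> N" using KN by (simp add: K_def)
    have N1: "1 \<le> N" using KN K1 by linarith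
    have Np: "N powr (- \<gamma>) = K powr (- \<gamma>) * t powr (1 + 2 * \<epsilon>)"
      using K1 t \<gamma> by (simp add: N_def powr_mult powr_powr \<alpha>_def add.commute)
    have err: "C * (log_card U)\<^sup>2 * N powr (- \<gamma>) \<le> t / 8"
    proof -
      have "0 \<le> log_card U" using log_card_ge_1[of U] U(1) by (simp add: boxed_def)
      then have "(log_card U)\<^sup>2 \<le> (C2 * t powr (- \<epsilon>))\<^sup>2" using \<Lambda> by (intro power_mono) auto
      also have "\<dots> = C2\<^sup>2 * t powr (- 2 * \<epsilon>)"
        using t by (simp add: power_mult_distrib powr_power)
      finally have "C * (log_card U)\<^sup>2 * N powr (- \<gamma>) \<le> C * (C2\<^sup>2 * t powr (- 2 * \<epsilon>)) * N powr (- \<gamma>)"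
        using C by (intro mult_right_mono mult_left_mono) auto
      also have "\<dots> = C * C2\<^sup>2 * K powr (- \<gamma>) * (t powr (- 2 * \<epsilon>) * t powr (1 + 2 * \<epsilon>))"
        unfolding Np by simp
      also have "t powr (- 2 * \<epsilon>) * t powr (1 + 2 * \<epsilon>) = t" using t by (simp add: powr_add[symmetric])
      also have "C * C2\<^sup>2 * K powr (- \<gamma>) * t \<le> (1 / 8) * t"
      proof (rule mult_right_mono)
        have "0 < K powr \<gamma>" using K1 by simp
        then show "C * C2\<^sup>2 * K powr (- \<gamma>) \<le> 1 / 8" using Kp by (simp add: powr_minus_divide divide_le_eq)
      qed (use t in simp)
      finally show ?thesis by simp
    qed
    define N' where "N' = nat \<lfloor>N\<rfloor>"
    have N': "real N' \<le> N" "0 < N'" using N1 unfolding N'_def by linarith+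
    define \<delta> where "\<delta> = t / (8 * n * N)"
    have \<delta>: "0 < \<delta>" using t n2 N1 by (simp add: \<delta>_def)
    define R where "R = nat \<lceil>W / \<delta> + 1\<rceil>"
    have "0 \<le> W / \<delta>" using W \<delta> by simp
    then have R: "W / \<delta> + 1 \<le> real R" "real R \<le> W / \<delta> + 2" unfolding R_def by linarith+
    have "net_entropy hausdorff_metric t (symmetric_zonoids_in_ball :: 'a set set)
        \<le> ereal (real N' * DIM('a) * ln (2 * real R + 1))"
    proof (rule net_entropy_zonoids_le[where U = U and D = "1 / p" and W = W and \<delta> = \<delta>])
      show "2 * (DIM('a) * (1 / real p) * W) \<le> t / 8"
      proof -
        have "16 * n * W \<le> t * p" using p(1) t by (simp add: field_simps)
        then show ?thesis using p(3) by (simp add: n_def field_simps)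
      qed
      show "real N' * (DIM('a) * \<delta>) \<le> t / 8"
      proof -
        have "real N' * (n * \<delta>) \<le> N * (n * \<delta>)" using N' n2 \<delta> by (intro mult_right_mono) auto
        also have "\<dots> = t / 8" using n2 N1 by (simp add: \<delta>_def)
        finally show ?thesis by (simp add: n_def)
      qed
      show "\<exists>ys. length ys \<le> N' \<and> total_size ys \<le> W \<and>
        (\<forall>u\<in>U. \<bar>segment_sum xs u - segment_sum ys u\<bar> \<le> t / 8)" if xW: "total_size xs \<le> W" for xs
      proof -
        obtain ys where ys: "real (length ys) \<le> N" "total_size ys \<le> W"
          "\<And>u. u \<in> U \<Longrightarrow> \<bar>segment_sum xs u - segment_sum ys u\<bar> \<le> C * (log_card U)\<^sup>2 * N powr (- \<gamma>)"
          using few[OF NM U(1) xW] by blast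
        have "length ys \<le> N'" using ys(1) unfolding N'_def by (simp add: le_nat_floor)
        moreover have "\<bar>segment_sum xs u - segment_sum ys u\<bar> \<le> t / 8" if "u \<in> U" for u
          using ys(3)[OF that] err by linarith
        ultimately show ?thesis using ys(2) by blast
      qed
    qed (use t U(3) \<delta> R(1) in \<open>auto simp: W_def n_def\<close>)
    also have "real N' * DIM('a) * ln (2 * real R + 1) \<le> K * n * C3 * t powr (- (2 * (n - 1) / (n + 2)) - \<eta>)"
    proof -
      have "2 * real R + 1 \<le> 2 * (W / \<delta>) + 5" using R(2) by simp
      also have "\<dots> = 16 * n * W * N / t + 5" by (simp add: \<delta>_def mult_ac)
      also have "\<dots> = 16 * n * W * K * t powr (- (\<alpha> + 1)) + 5 * 1"
      proof -
        have "t powr (- (\<alpha> + 1)) = t powr (- \<alpha>) / t" using t powr_diff[of t "- \<alpha>" 1] by simp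
        then show ?thesis by (simp add: N_def)
      qed
      also have "\<dots> \<le> 16 * n * W * K * t powr (- (\<alpha> + 1)) + 5 * t powr (- (\<alpha> + 1))"
        using ge1[of "\<alpha> + 1"] \<alpha>(1) by (intro add_left_mono mult_left_mono) auto
      also have "\<dots> = A' * t powr (- (\<alpha> + 1))" by (simp add: A'_def algebra_simps)
      finally have "ln (2 * real R + 1) \<le> ln (A' * t powr (- (\<alpha> + 1)))" by (intro ln_mono) auto
      also have "\<dots> \<le> C3 * t powr (- \<epsilon>)" using C3(2)[of t] t by simp
      finally have l: "ln (2 * real R + 1) \<le> C3 * t powr (- \<epsilon>)" .
      have "real N' * DIM('a) * ln (2 * real R + 1) \<le> (N * n) * (C3 * t powr (- \<epsilon>))"
        using N' N1 n2 C3(1) by (intro mult_mono l) (auto simp: n_def)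
      also have "\<dots> = K * n * C3 * (t powr (- \<alpha>) * t powr (- \<epsilon>))" by (simp add: N_def)
      also have "t powr (- \<alpha>) * t powr (- \<epsilon>) = t powr (- (\<alpha> + \<epsilon>))" by (simp add: powr_add[symmetric])
      also have "K * n * C3 * t powr (- (\<alpha> + \<epsilon>)) \<le> K * n * C3 * t powr (- (2 * (n - 1) / (n + 2)) - \<eta>)"
        using \<alpha>(2) t K1 n2 C3(1) by (intro mult_left_mono powr_mono') auto
      finally show ?thesis .
    qed
    finally show ?thesis by simp
  qed
  then show ?thesis by blast
qed

theorem theorem7p3:
  fixes \<eta> :: real
  assumes "CARD('n::finite) \<ge> 3" and "\<eta> > 0"
  shows "\<exists>c::real. \<forall>t::real. 0 < t \<and> t < 1/2 \<longrightarrow>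
    net_entropy hausdorff_metric t (symmetric_zonoids_in_ball :: (real ^ 'n) set set)
      \<le> ereal (c * t powr (- (2 * (real CARD('n) - 1) / (real CARD('n) + 2)) - \<eta>))"
  using net_entropy_zonoids_asymptotic[where 'a = "real ^ 'n", OF _ assms(2)] assms(1) by simp

end
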